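(* Let $\mathcal H$ be a real Hilbert space with a complex structure $J$, and let $\epsilon_0,\epsilon_1\in\Lambda_J(\mathcal H)$. Then there exists a geodesic of $\Lambda_J(\mathcal H)$ joining $\epsilon_0$ and $\epsilon_1$ inside $\Lambda_J(\mathcal H)$. The geodesic is of the form $\delta(t)=e^{2tz}\epsilon_0$, $t\in[0,1]$, where $z$ is a bounded operator on $\mathcal H$ with $z^*=-z$, $z\epsilon_0=-\epsilon_0z$, $zJ=Jz$ and $\|z\|\le\pi/2$ (so $\delta(0)=\epsilon_0$, $\delta(1)=\epsilon_1$). If $\|\epsilon_0-\epsilon_1\|<2$, the geodesic of this form is unique.
   Context: $\mathcal H$ is a real Hilbert space (finite or infinite dimensional); $J$ is a bounded operator on $\mathcal H$ with $J^*=-J$ and $J^2=-I$ (here $*$ is the transpose). A closed subspace $L\subset\mathcal H$ is Lagrangian if $J(L)=L^\perp$. A closed subspace $S$ is identified with the symmetry $\epsilon_S=2p_S-I$, where $p_S$ is the orthogonal projection onto $S$. Under this identification the Lagrangian Grassmannian is $\Lambda_J(\mathcal H)=\{\epsilon\in\mathcal B(\mathcal H):\epsilon^*=\epsilon=\epsilon^{-1},\ \epsilon J=-J\epsilon\}$, a submanifold of the real Grassmannian $Gr(\mathcal H)=\{\epsilon\in\mathcal B(\mathcal H):\epsilon^*=\epsilon=\epsilon^{-1}\}$. The linear connection on $Gr(\mathcal H)$, and on $\Lambda_J(\mathcal H)$ by restriction, is given by the covariant derivative $\frac{D}{dt}X=\Pi_{\gamma(t)}(\dot X(t))$ of a tangent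 field $X$ along a curve $\gamma$, where $\Pi_\epsilon(a)=\frac12(a-\epsilon a\epsilon)$. Its geodesics starting at $\epsilon_0$ in $Gr(\mathcal H)$ are the curves $e^{tz}\epsilon_0e^{-tz}=e^{2tz}\epsilon_0$ with $z^*=-z$, $z\epsilon_0=-\epsilon_0z$; those of $\Lambda_J(\mathcal H)$ are the ones with in addition $zJ=Jz$. Norms of operators are operator norms. *)

theory Defs
  imports "HOL-Analysis.Analysis"
begin

text \<open>
  A real Hilbert space is a type of sort \<open>{real_inner, banach}\<close>; no assumption is made on its
  dimension. Bounded operators are elements of \<open>'a \<Rightarrow>\<^sub>L 'a\<close>, normed by the operator norm.
\<close>

subsection \<open>Adjoints of bounded operators\<close>

definition adj :: "('a::{real_inner,banach} \<Rightarrow>\<^sub>L 'a) \<Rightarrow> ('a \<Rightarrow>\<^sub>L 'a)"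
  where "adj A = Blinfun (adjoint (blinfun_apply A))"

text \<open>
  Since \<^const>\<open>adjoint\<close> is defined by a choice operator, the Riesz representation
  theorem is needed to see that \<open>adj A\<close> is the Hilbert space adjoint of every bounded operator.
\<close>

lemma riesz_representation:
  fixes f :: "'a::{real_inner,banach} \<Rightarrow> real"
  assumes f: "bounded_linear f"
  shows "\<exists>u. \<forall>v. f v = u \<bullet> v"
proof -
  interpret f: bounded_linear f by (rule f)
  define F where "F x = (x \<bullet> x) / 2 - f x" for x
  obtain K where K: "\<And>x. norm (f x) \<le> norm x * K" using f.bounded by blast
  have lower: "F x \<ge> - (K\<^sup>2) / 2" for x
  proof -
    have "f x \<le> norm x * K" using K[of x] by simp
    moreover have "0 \<le> (norm x - K)\<^sup>2" by simp
    ultimately show ?thesis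
      by (simp add: F_def power2_norm_eq_inner[symmetric] power2_diff field_simps)
  qed
  define m where "m = (INF x. F x)"
  have bdd: "bdd_below (range F)" using lower by (intro bdd_belowI2) auto
  have m_le: "m \<le> F x" for x unfolding m_def by (rule cINF_lower[OF bdd]) simp
  have "\<exists>x. F x < m + inverse (real (Suc n))" for n
    using cINF_less_iff[OF _ bdd, of "m + inverse (real (Suc n))"] by (simp add: m_def)
  then obtain X where X: "\<And>n. F (X n) < m + inverse (real (Suc n))" by metis
  have par: "(norm (x - y))\<^sup>2 \<le> 4 * (F x + F y - 2 * m)" for x y
  proof -
    have "(norm (x - y))\<^sup>2 = 4 * (F x + F y - 2 * F ((1/2) *\<^sub>R (x + y)))"
      by (simp add: F_def power2_norm_eq_inner f.scaleR f.add inner_commute algebra_simps)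
    then show ?thesis using m_le[of "(1/2) *\<^sub>R (x + y)"] by simp
  qed
  have "Cauchy X"
  proof (rule CauchyI)
    fix e :: real assume e: "0 < e"
    then obtain N where N: "inverse (real (Suc N)) < e\<^sup>2 / 8"
      using reals_Archimedean[of "e\<^sup>2 / 8"] by auto
    have "norm (X i - X j) < e" if "N \<le> i" "N \<le> j" for i j
    proof -
      have inv: "inverse (real (Suc i)) \<le> inverse (real (Suc N))"
                "inverse (real (Suc j)) \<le> inverse (real (Suc N))"
        using that by (auto intro!: le_imp_inverse_le)
      have "(norm (X i - X j))\<^sup>2 < e\<^sup>2"
      proof -
        have "F (X i) - m < e\<^sup>2 / 8" "F (X j) - m < e\<^sup>2 / 8"
          using X[of i] X[of j] inv N by (smt (verit))+
        then show ?thesis using par[of "X i" "X j"] by argo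
      qed
      then show ?thesis using e power_less_imp_less_base by fastforce
    qed
    then show "\<exists>M. \<forall>m\<ge>M. \<forall>n\<ge>M. norm (X m - X n) < e" by blast
  qed
  then obtain u where u: "X \<longlonglongrightarrow> u" using Cauchy_convergent convergent_def by blast
  have "(\<lambda>n. F (X n)) \<longlonglongrightarrow> F u"
    unfolding F_def by (intro tendsto_intros u f.tendsto) simp
  moreover have "(\<lambda>n. m + inverse (real (Suc n))) \<longlonglongrightarrow> m + 0"
    by (intro tendsto_intros LIMSEQ_inverse_real_of_nat)
  ultimately have Fu: "F u \<le> m"
    using X by (auto intro: LIMSEQ_le less_imp_le)
  have "f v = u \<bullet> v" for v
  proof (rule ccontr)
    assume ne: "f v \<noteq> u \<bullet> v"
    define c where "c = u \<bullet> v - f v"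
    define q where "q = v \<bullet> v + 1"
    have c: "c \<noteq> 0" using ne by (simp add: c_def)
    have q: "q > 0" "v \<bullet> v \<le> q" by (simp_all add: q_def add_nonneg_pos)
    define t where "t = - c / q"
    have "F (u + t *\<^sub>R v) = F u + t * c + t\<^sup>2 * (v \<bullet> v) / 2"
      by (simp add: F_def c_def f.add f.scaleR inner_add_left inner_add_right
          inner_commute[of v u] power2_eq_square field_simps)
    moreover have "t\<^sup>2 * (v \<bullet> v) \<le> t\<^sup>2 * q" using q by (intro mult_left_mono) auto
    moreover have "t\<^sup>2 * q = c\<^sup>2 / q" "t * c = - (c\<^sup>2 / q)"
      using q by (simp_all add: t_def power2_eq_square field_simps)
    moreover have "c\<^sup>2 / q > 0" using c q by simp
    ultimately have "F (u + t *\<^sub>R v) < m" using Fu by linarith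
    then show False using m_le[of "u + t *\<^sub>R v"] by linarith
  qed
  then show ?thesis by blast
qed

lemma blinfun_adjoint_exists:
  fixes A :: "'a::{real_inner,banach} \<Rightarrow>\<^sub>L 'a"
  shows "\<exists>B :: 'a \<Rightarrow>\<^sub>L 'a. \<forall>x y. A x \<bullet> y = x \<bullet> B y"
proof -
  have "\<exists>u. \<forall>v. A v \<bullet> y = u \<bullet> v" for y
    by (rule riesz_representation)
      (intro bounded_linear_inner_left_comp blinfun.bounded_linear_right)
  then obtain g where g: "\<And>v y. A v \<bullet> y = v \<bullet> g y" by (metis inner_commute)
  have eqI: "a = b" if "\<And>v. v \<bullet> a = v \<bullet> b" for a b :: 'a
    using that[of "a - b"] by (metis inner_diff_right inner_eq_zero_iff right_minus_eq)
  have "bounded_linear g"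
  proof (rule bounded_linear_intro[where K = "norm A"])
    show "g (x + y) = g x + g y" for x y
      by (rule eqI) (simp add: g[symmetric] inner_add_right)
    show "g (r *\<^sub>R x) = r *\<^sub>R g x" for r x
      by (rule eqI) (simp add: g[symmetric])
    show "norm (g x) \<le> norm x * norm A" for x
    proof (cases "norm (g x) = 0")
      case False
      have "norm (g x) * norm (g x) = A (g x) \<bullet> x"
        by (simp add: g power2_norm_eq_inner[symmetric] power2_eq_square)
      also have "\<dots> \<le> norm (A (g x)) * norm x" by (rule norm_cauchy_schwarz)
      also have "\<dots> \<le> (norm A * norm (g x)) * norm x"
        by (intro mult_right_mono norm_blinfun) simp
      finally have "norm (g x) * norm (g x) \<le> norm (g x) * (norm x * norm A)"
        by (simp add: mult_ac)
      then show ?thesis using False by (metis mult_le_cancel_left_pos norm_ge_zero order_le_less)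
    qed simp
  qed
  then show ?thesis using g by (intro exI[of _ "Blinfun g"]) (simp add: bounded_linear_Blinfun_apply)
qed

lemma adj_eq_iff: "adj A = B \<longleftrightarrow> (\<forall>x y. A x \<bullet> y = x \<bullet> B y)"
proof -
  obtain C where C: "\<forall>x y. A x \<bullet> y = x \<bullet> blinfun_apply C y"
    using blinfun_adjoint_exists by blast
  have adj: "adj A = D" if "\<forall>x y. A x \<bullet> y = x \<bullet> blinfun_apply D y" for D
    using adjoint_unique[OF that] by (simp add: adj_def blinfun_apply_inverse)
  show ?thesis using adj C by metis
qed

subsection \<open>The Lagrangian Grassmannian\<close>

definition complex_structure :: "('a::{real_inner,banach} \<Rightarrow>\<^sub>L 'a) \<Rightarrow> bool"
  where "complex_structure J \<longleftrightarrow> adj J = - J \<and> J o\<^sub>L J = - id_blinfun"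

text \<open>
  A closed subspace \<open>S\<close> is represented by the symmetry \<open>2 p\<^sub>S - I\<close>, where \<open>p\<^sub>S\<close> is the orthogonal
  projection onto \<open>S\<close>. The condition \<open>\<epsilon> o\<^sub>L \<epsilon> = id_blinfun\<close> says \<open>\<epsilon> = \<epsilon>\<^sup>-\<^sup>1\<close>.
\<close>

definition grassmannian :: "('a::{real_inner,banach} \<Rightarrow>\<^sub>L 'a) set"
  where "grassmannian = {\<epsilon>. adj \<epsilon> = \<epsilon> \<and> \<epsilon> o\<^sub>L \<epsilon> = id_blinfun}"

definition lagrangian_grassmannian ::
    "('a::{real_inner,banach} \<Rightarrow>\<^sub>L 'a) \<Rightarrow> ('a \<Rightarrow>\<^sub>L 'a) set"
  where "lagrangian_grassmannian J = {\<epsilon> \<in> grassmannian. \<epsilon> o\<^sub>L J = - (J o\<^sub>L \<epsilon>)}"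

subsection \<open>The linear connection and its geodesics\<close>

definition tangent_proj ::
    "('a::{real_inner,banach} \<Rightarrow>\<^sub>L 'a) \<Rightarrow> ('a \<Rightarrow>\<^sub>L 'a) \<Rightarrow> ('a \<Rightarrow>\<^sub>L 'a)"
  where "tangent_proj \<epsilon> a = (1 / 2) *\<^sub>R (a - (\<epsilon> o\<^sub>L a o\<^sub>L \<epsilon>))"

definition covariant_derivative ::
    "(real \<Rightarrow> 'a::{real_inner,banach} \<Rightarrow>\<^sub>L 'a) \<Rightarrow> (real \<Rightarrow> 'a \<Rightarrow>\<^sub>L 'a) \<Rightarrow> real set \<Rightarrow> real \<Rightarrow> ('a \<Rightarrow>\<^sub>L 'a)"
  where "covariant_derivative \<gamma> X T t = tangent_proj (\<gamma> t) (vector_derivative X (at t within T))"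

text \<open>
  A geodesic in \<open>M\<close> (\<^const>\<open>grassmannian\<close> or \<^term>\<open>lagrangian_grassmannian J\<close>, which carries the
  restricted connection) on \<open>[a, b]\<close>; \<open>V\<close> is the velocity field of \<open>\<gamma>\<close>. Two derivatives suffice:
  differentiating \<open>\<gamma>\<^sup>2 = I\<close> twice turns the equation into \<open>\<gamma>'' = - \<gamma> (\<gamma>')\<^sup>2\<close>, so that \<open>\<gamma>\<close> is smooth.
\<close>

definition geodesic_in ::
    "('a::{real_inner,banach} \<Rightarrow>\<^sub>L 'a) set \<Rightarrow> real \<Rightarrow> real \<Rightarrow> (real \<Rightarrow> 'a \<Rightarrow>\<^sub>L 'a) \<Rightarrow> bool"
  where "geodesic_in M a b \<gamma> \<longleftrightarrow>
    (\<forall>t\<in>{a..b}. \<gamma> t \<in> M) \<and>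
    (\<exists>V. \<forall>t\<in>{a..b}.
       (\<gamma> has_vector_derivative V t) (at t within {a..b}) \<and>
       V differentiable (at t within {a..b}) \<and>
       covariant_derivative \<gamma> V {a..b} t = 0)"

text \<open>
  The type \<open>'a \<Rightarrow>\<^sub>L 'a\<close> is not an instance of \<^class>\<open>real_normed_algebra_1\<close> (the norm of the
  identity is 0 on the zero space), so the exponential series is written out.
\<close>

definition exp_op :: "('a::{real_inner,banach} \<Rightarrow>\<^sub>L 'a) \<Rightarrow> ('a \<Rightarrow>\<^sub>L 'a)"
  where "exp_op A = (\<Sum>n. (1 / fact n) *\<^sub>R (((o\<^sub>L) A ^^ n) id_blinfun))"

definition exp_curve ::
    "('a::{real_inner,banach} \<Rightarrow>\<^sub>L 'a) \<Rightarrow> ('a \<Rightarrow>\<^sub>L 'a) \<Rightarrow> real \<Rightarrow> ('a \<Rightarrow>\<^sub>L 'a)"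
  where "exp_curve \<epsilon> z t = exp_op ((2 * t) *\<^sub>R z) o\<^sub>L \<epsilon>"

end

theory Submission
  imports Defs
begin

text \<open>
  The orthogonal operator \<open>V = \<epsilon>\<^sub>1 \<epsilon>\<^sub>0\<close> has to be written as \<open>e\<^sup>2\<^sup>z\<close>. A midpoint of \<open>\<epsilon>\<^sub>0\<close> and \<open>\<epsilon>\<^sub>1\<close> is
  an \<open>\<epsilon> \<in> \<Lambda>\<^sub>J\<close> with \<open>\<epsilon> \<epsilon>\<^sub>0 \<epsilon> = \<epsilon>\<^sub>1\<close> and \<open>Re (\<epsilon> \<epsilon>\<^sub>0) \<ge> 0\<close>, so that \<open>\<epsilon> \<epsilon>\<^sub>0\<close> is a square root of \<open>V\<close>. It is
  the sign of \<open>\<epsilon>\<^sub>0 + \<epsilon>\<^sub>1\<close>, completed on the kernel of \<open>\<epsilon>\<^sub>0 + \<epsilon>\<^sub>1\<close> with the help of \<open>J\<close>. Taking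
  midpoints of \<open>\<epsilon>\<^sub>0\<close> and the previous midpoint over and over yields iterated square roots of \<open>V\<close>,
  and \<open>z\<close> is their rescaled limit; no spectral theorem is needed.

  Conversely \<open>Re e\<^sup>s\<^sup>z \<ge> 0\<close> for \<open>0 \<le> s \<le> 1\<close> if \<open>z\<close> is skew with \<open>\<parallel>z\<parallel> \<le> \<pi> / 2\<close>. If \<open>\<parallel>\<epsilon>\<^sub>0 - \<epsilon>\<^sub>1\<parallel> < 2\<close>, then
  \<open>V + 1\<close> is injective and square roots with nonnegative real part are unique. Hence \<open>V\<close>
  determines all \<open>exp (z / 2\<^sup>k)\<close>, and with them \<open>z\<close>.
\<close>

section \<open>Algebra of operator composition\<close>

lemmas comp_simps =
  bounded_bilinear.add_left[OF bounded_bilinear_blinfun_compose]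
  bounded_bilinear.add_right[OF bounded_bilinear_blinfun_compose]
  bounded_bilinear.diff_left[OF bounded_bilinear_blinfun_compose]
  bounded_bilinear.diff_right[OF bounded_bilinear_blinfun_compose]
  bounded_bilinear.minus_left[OF bounded_bilinear_blinfun_compose]
  bounded_bilinear.minus_right[OF bounded_bilinear_blinfun_compose]
  bounded_bilinear.scaleR_left[OF bounded_bilinear_blinfun_compose]
  bounded_bilinear.scaleR_right[OF bounded_bilinear_blinfun_compose]

lemma comp_assoc: "(A o\<^sub>L B) o\<^sub>L C = A o\<^sub>L (B o\<^sub>L C)"
  by (rule blinfun_eqI) simp

lemma comp_id [simp]: "A o\<^sub>L id_blinfun = A" "id_blinfun o\<^sub>L A = A"
  by (rule blinfun_eqI, simp)+

lemma comp_eq_iff: "A o\<^sub>L B = C o\<^sub>L D \<longleftrightarrow> (\<forall>x. A (B x) = C (D x))"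
  by (metis blinfun_apply_blinfun_compose blinfun_eqI)

subsection \<open>Adjoints\<close>

lemma adj_inner: "blinfun_apply A x \<bullet> y = x \<bullet> adj A y"
  using adj_eq_iff by blast

lemma adj_inner': "x \<bullet> blinfun_apply A y = adj A x \<bullet> y"
  by (metis adj_inner inner_commute)

lemma adj_adj [simp]: "adj (adj A) = A"
  by (simp add: adj_eq_iff adj_inner')

lemma adj_comp [simp]: "adj (A o\<^sub>L B) = adj B o\<^sub>L adj A"
  by (metis (no_types, lifting) adj_eq_iff adj_inner blinfun_apply_blinfun_compose)

lemma adj_add [simp]: "adj (A + B) = adj A + adj B"
  by (simp add: adj_eq_iff blinfun.bilinear_simps inner_add_left inner_add_right
    adj_inner)

lemma adj_diff [simp]: "adj (A - B) = adj A - adj B"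
  by (simp add: adj_eq_iff blinfun.bilinear_simps inner_diff_left inner_diff_right
    adj_inner)

lemma adj_uminus [simp]: "adj (- A) = - adj A"
  by (simp add: adj_eq_iff blinfun.bilinear_simps adj_inner)

lemma adj_scaleR [simp]: "adj (c *\<^sub>R A) = c *\<^sub>R adj A"
  by (simp add: adj_eq_iff blinfun.bilinear_simps adj_inner)

lemma adj_id [simp]: "adj id_blinfun = id_blinfun"
  by (simp add: adj_eq_iff)

lemma adj_zero [simp]: "adj 0 = 0"
  by (simp add: adj_eq_iff)

lemma sadj_inner: "adj A = A \<Longrightarrow> blinfun_apply A x \<bullet> y = x \<bullet> A y"
  by (simp add: adj_inner)

lemma norm_adj_le: "norm (adj A) \<le> norm A"
proof (rule norm_blinfun_bound)
  fix x
  have "norm (adj A x) * norm (adj A x) = A (adj A x) \<bullet> x"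
    by (metis adj_inner inner_commute norm_eq_sqrt_inner power2_eq_square power2_norm_eq_inner)
  also have "\<dots> \<le> norm (A (adj A x)) * norm x" by (rule norm_cauchy_schwarz)
  also have "\<dots> \<le> (norm A * norm (adj A x)) * norm x"
    by (intro mult_right_mono norm_blinfun) simp
  finally have "norm (adj A x) * norm (adj A x) \<le> norm (adj A x) * (norm A * norm x)"
    by (simp add: mult_ac)
  then show "norm (adj A x) \<le> norm A * norm x"
    by (cases "adj A x = 0") (auto simp: mult_le_cancel_left)
qed simp

lemma norm_adj [simp]: "norm (adj A) = norm A"
  using norm_adj_le[of A] norm_adj_le[of "adj A"] by simp

lemma norm_orthogonal:
  assumes "adj U o\<^sub>L U = id_blinfun"
  shows "norm (U x) = norm x"
proof -
  have "U x \<bullet> U x = x \<bullet> x"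
    by (metis adj_inner assms blinfun_apply_blinfun_compose blinfun_apply_id_blinfun)
  then show ?thesis by (simp add: norm_eq_sqrt_inner)
qed

subsection \<open>Positive operators\<close>

definition pos_op :: "('a::{real_inner,banach} \<Rightarrow>\<^sub>L 'a) \<Rightarrow> bool"
  where "pos_op A \<longleftrightarrow> adj A = A \<and> (\<forall>x. 0 \<le> A x \<bullet> x)"

lemma pos_op_add: "pos_op A \<Longrightarrow> pos_op B \<Longrightarrow> pos_op (A + B)"
  by (simp add: pos_op_def blinfun.bilinear_simps inner_add_left)

lemma pos_op_scaleR: "0 \<le> c \<Longrightarrow> pos_op A \<Longrightarrow> pos_op (c *\<^sub>R A)"
  by (simp add: pos_op_def blinfun.bilinear_simps)

lemma pos_op_square: "adj A = A \<Longrightarrow> pos_op (A o\<^sub>L A)"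
  by (simp add: pos_op_def) (metis adj_inner inner_ge_zero)

text \<open>The quadratic form of the product at \<open>x\<close> is that of \<open>A\<close> at
  \<open>B x\<close>. This is the case of \<open>pos_op_comp\<close> in which one factor is a
  square.\<close>

lemma pos_op_conj:
  assumes "pos_op A" "adj B = B" "A o\<^sub>L B = B o\<^sub>L A"
  shows "pos_op (B o\<^sub>L B o\<^sub>L A)"
  unfolding pos_op_def
proof
  have AB: "A (B x) = B (A x)" for x using assms(3) comp_eq_iff by blast
  then show "adj (B o\<^sub>L B o\<^sub>L A) = B o\<^sub>L B o\<^sub>L A"
    using assms by (auto simp: pos_op_def intro!: blinfun_eqI)
  have "(B o\<^sub>L B o\<^sub>L A) x \<bullet> x = A (B x) \<bullet> B x" for x
    using sadj_inner[OF assms(2)] AB by simp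
  then show "\<forall>x. 0 \<le> (B o\<^sub>L B o\<^sub>L A) x \<bullet> x" using assms(1) by (simp add: pos_op_def)
qed

lemma pos_op_null:
  assumes "pos_op A" "A x \<bullet> x = 0"
  shows "A x = 0"
proof -
  have sa: "A u \<bullet> v = u \<bullet> A v" for u v using assms(1) by (simp add: pos_op_def sadj_inner)
  define c where "c = A (A x) \<bullet> A x"
  have c0: "0 \<le> c" using assms(1) by (simp add: pos_op_def c_def)
  have pos: "0 \<le> s\<^sup>2 * c - 2 * s * (A x \<bullet> A x)" for s
  proof -
    have "0 \<le> A (x - s *\<^sub>R A x) \<bullet> (x - s *\<^sub>R A x)" using assms(1) by (simp add: pos_op_def)
    also have "\<dots> = s\<^sup>2 * c - 2 * s * (A x \<bullet> A x)"
      using assms(2) sa[of "A x" x]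
      by (simp add: blinfun.bilinear_simps inner_diff_left inner_diff_right c_def
          power2_eq_square algebra_simps)
    finally show ?thesis .
  qed
  \<comment> \<open>For \<open>c > 0\<close> the quadratic in \<open>s\<close> is smallest at
    \<open>(A x \<bullet> A x) / c\<close>. The denominator \<open>c + 1\<close> also covers
    \<open>c = 0\<close>, and the value stays negative unless \<open>A x = 0\<close>.\<close>
  define s where "s = (A x \<bullet> A x) / (c + 1)"
  have "s\<^sup>2 * c - 2 * s * (A x \<bullet> A x) = - s\<^sup>2 * (c + 2)"
  proof -
    have "A x \<bullet> A x = s * (c + 1)" using c0 by (simp add: s_def)
    then show ?thesis by (simp add: power2_eq_square algebra_simps)
  qed
  then have "s\<^sup>2 * (c + 2) \<le> 0" using pos[of s] by simp
  then have "s\<^sup>2 \<le> 0" using c0 by (simp add: mult_le_0_iff)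
  then have "s = 0" by simp
  then show ?thesis using c0 by (simp add: s_def)
qed

text \<open>F. Riesz' argument: for \<open>A \<le> 1\<close>, with \<open>B\<^sub>0 = A\<close> and \<open>B\<^sub>n\<^sub>+\<^sub>1 = B\<^sub>n - B\<^sub>n\<^sup>2\<close> one has
  \<open>A = \<Sum> B\<^sub>n\<^sup>2\<close> strongly, where all \<open>B\<^sub>n\<close> commute with \<open>B\<close>.\<close>

lemma pos_op_comp:
  fixes A B :: "'a::{real_inner,banach} \<Rightarrow>\<^sub>L 'a"
  assumes A: "pos_op A" and B: "pos_op B" and AB: "A o\<^sub>L B = B o\<^sub>L A"
  shows "pos_op (A o\<^sub>L B)"
proof -
  define D where "D = (inverse (norm A)) *\<^sub>R A"
  define R where "R = rec_nat D (\<lambda>_ C. C - (C o\<^sub>L C))"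
  have R0: "R 0 = D" and RS: "R (Suc n) = R n - (R n o\<^sub>L R n)" for n by (simp_all add: R_def)
  have D1: "D x \<bullet> x \<le> x \<bullet> x" for x
  proof (cases "norm A = 0")
    case False
    have "A x \<bullet> x \<le> norm A * norm x * norm x"
      by (meson norm_blinfun norm_cauchy_schwarz mult_right_mono norm_ge_zero order_trans)
    then show ?thesis using False
      by (simp add: D_def blinfun.bilinear_simps divide_simps power2_norm_eq_inner[symmetric]
        power2_eq_square mult_ac)
  qed (simp add: D_def)
  have inv: "adj (R n) = R n \<and> (\<forall>x. 0 \<le> R n x \<bullet> x \<and> R n x \<bullet> x \<le> x \<bullet> x)" for n
  proof (induction n)
    case 0
    have "pos_op D" using A by (simp add: D_def pos_op_scaleR)
    then show ?case using D1 by (simp add: R0 pos_op_def)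
  next
    case (Suc n)
    have sa: "R n u \<bullet> v = u \<bullet> R n v" for u v using Suc sadj_inner by blast
    define y where "y x = x - R n x" for x
    \<comment> \<open>With \<open>C = R n\<close>,
      \<open>C - C^2 = (1 - C) C (1 - C) + C (1 - C) C\<close>; both terms are positive because
      \<open>0 \<le> C \<le> 1\<close>.\<close>
    have "R (Suc n) x \<bullet> x = R n (y x) \<bullet> y x + (R n x \<bullet> R n x - R n (R n x) \<bullet> R n x)" for x
      using sa[of "R n x" x] sa[of "R n (R n x)" x] sa[of "R n x" "R n x"] sa[of x x]
      by (simp add: RS y_def blinfun.bilinear_simps inner_diff_left inner_diff_right inner_commute)
    then have "0 \<le> R (Suc n) x \<bullet> x" for x using Suc by simp
    moreover have "R (Suc n) x \<bullet> x \<le> x \<bullet> x" for x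
    proof -
      have "R (Suc n) x \<bullet> x = R n x \<bullet> x - R n x \<bullet> R n x"
        using sa[of "R n x" x] by (simp add: RS blinfun.bilinear_simps inner_diff_left)
      then show ?thesis using Suc inner_ge_zero[of "R n x"] by (smt (verit))
    qed
    ultimately show ?case using Suc by (simp add: RS)
  qed
  have sa: "R n u \<bullet> v = u \<bullet> R n v" for n u v using inv sadj_inner by blast
  have comm: "R n (B x) = B (R n x)" for n x
  proof (induction n arbitrary: x)
    case 0
    have "A (B x) = B (A x)" using AB comp_eq_iff by blast
    then show ?case by (simp add: R0 D_def blinfun.bilinear_simps)
  next
    case (Suc n)
    then show ?case by (simp add: RS blinfun.bilinear_simps)
  qed
  have sum: "D x = (\<Sum>k<n. R k (R k x)) + R n x" for x n
    by (induction n) (simp_all add: R0 RS blinfun.bilinear_simps)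
  \<comment> \<open>By telescoping, the squared norms of \<open>R k x\<close> have partial sums
    bounded by \<open>D x \<bullet> x\<close>. Hence the remainder \<open>R n x\<close> in the
    expansion of \<open>D x\<close> tends to 0.\<close>
  have "(\<lambda>n. R n x \<bullet> R n x) \<longlonglongrightarrow> 0" for x
  proof (rule summable_LIMSEQ_zero)
    show "summable (\<lambda>n. R n x \<bullet> R n x)"
    proof (rule summableI_nonneg_bounded)
      fix n
      have "D x \<bullet> x = (\<Sum>k<n. R k x \<bullet> R k x) + R n x \<bullet> x"
        by (subst sum[of x n]) (simp add: inner_add_left inner_sum_left sa)
      moreover have "0 \<le> R n x \<bullet> x" using inv by blast
      ultimately show "(\<Sum>k<n. R k x \<bullet> R k x) \<le> D x \<bullet> x" by linarith
    qed simp
  qed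
  then have "(\<lambda>n. sqrt (R n x \<bullet> R n x)) \<longlonglongrightarrow> sqrt 0" for x by (intro tendsto_intros)
  then have lim: "(\<lambda>n. R n x) \<longlonglongrightarrow> 0" for x
    by (simp add: norm_eq_sqrt_inner[symmetric] tendsto_norm_zero_iff)
  \<comment> \<open>All \<open>R k\<close> are self-adjoint and commute with \<open>B\<close>, so
    \<open>D (B x) \<bullet> x\<close> is a sum of terms
    \<open>B (R k x) \<bullet> R k x \<ge> 0\<close> plus a remainder tending to 0.\<close>
  have D: "0 \<le> D (B x) \<bullet> x" for x
  proof (rule tendsto_upperbound)
    show "(\<lambda>n. R n (B x) \<bullet> x) \<longlonglongrightarrow> 0" using tendsto_inner[OF lim tendsto_const] by fastforce
    show "\<forall>\<^sub>F n in sequentially. R n (B x) \<bullet> x \<le> D (B x) \<bullet> x"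
    proof (intro always_eventually allI)
      fix n
      have "D (B x) \<bullet> x = (\<Sum>k<n. B (R k x) \<bullet> R k x) + R n (B x) \<bullet> x"
        by (subst sum[of "B x" n]) (simp add: inner_add_left inner_sum_left sa comm[symmetric])
      moreover have "0 \<le> (\<Sum>k<n. B (R k x) \<bullet> R k x)"
        using B by (intro sum_nonneg) (simp add: pos_op_def)
      ultimately show "R n (B x) \<bullet> x \<le> D (B x) \<bullet> x" by linarith
    qed
  qed simp
  have AD: "A = norm A *\<^sub>R D" by (cases "A = 0") (simp_all add: D_def)
  have "0 \<le> A (B x) \<bullet> x" for x
    using D[of x] by (subst AD) (simp add: blinfun.bilinear_simps)
  moreover have "adj (A o\<^sub>L B) = A o\<^sub>L B" using A B AB by (simp add: pos_op_def)
  ultimately show ?thesis by (simp add: pos_op_def)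
qed

text \<open>With \<open>D = A - B\<close>, \<open>A\<^sup>2 = B\<^sup>2\<close> gives \<open>A D = - D B\<close>. Hence \<open>A D\<^sup>2 = - D B D\<close> is
  self-adjoint, both positive and negative, and so \<open>0\<close>; likewise \<open>B D\<^sup>2 = 0\<close>.\<close>

lemma pos_op_root_unique:
  fixes A B :: "'a::{real_inner,banach} \<Rightarrow>\<^sub>L 'a"
  assumes A: "pos_op A" and B: "pos_op B" and sq: "A o\<^sub>L A = B o\<^sub>L B"
  shows "A = B"
proof -
  have zero: "A o\<^sub>L (D o\<^sub>L D) = 0"
    if A: "pos_op A" and B: "pos_op B" and sq: "A o\<^sub>L A = B o\<^sub>L B" and D: "D = A - B"
    for A B D :: "'a \<Rightarrow>\<^sub>L 'a"
  proof -
    have adj: "adj A = A" "adj B = B" "adj D = D" using A B D by (auto simp: pos_op_def)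
    have "A o\<^sub>L D = - (D o\<^sub>L B)" using sq by (simp add: D comp_simps)
    then have e: "A o\<^sub>L (D o\<^sub>L D) = - (D o\<^sub>L (B o\<^sub>L D))"
      by (simp add: comp_assoc[symmetric] comp_simps)
    have "adj (A o\<^sub>L (D o\<^sub>L D)) = A o\<^sub>L (D o\<^sub>L D)"
      unfolding e by (simp add: adj comp_assoc)
    then have "pos_op (A o\<^sub>L (D o\<^sub>L D))"
      by (intro pos_op_comp A pos_op_square adj) (simp add: adj)
    moreover have "(A o\<^sub>L (D o\<^sub>L D)) x \<bullet> x \<le> 0" for x
      unfolding e using sadj_inner[OF adj(3), of "B (D x)" x] B
      by (simp add: blinfun.bilinear_simps pos_op_def)
    ultimately have "(A o\<^sub>L (D o\<^sub>L D)) x = 0" for x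
      by (meson order_antisym pos_op_def pos_op_null)
    then show ?thesis by (intro blinfun_eqI) simp
  qed
  define D where "D = A - B"
  have adjD: "adj D = D" using A B by (simp add: D_def pos_op_def)
  have "B o\<^sub>L ((B - A) o\<^sub>L (B - A)) = 0" by (rule zero[OF B A sq[symmetric] refl])
  moreover have "(B - A) o\<^sub>L (B - A) = D o\<^sub>L D" by (simp add: D_def comp_simps)
  \<comment> \<open>The difference of \<open>A D^2 = 0\<close> and \<open>B D^2 = 0\<close> is
    \<open>D^3 = 0\<close>. A self-adjoint nilpotent operator is 0: the squared norm of
    \<open>D (D x)\<close> is \<open>D (D (D x)) \<bullet> D x\<close>, and similarly for
    \<open>D x\<close>.\<close>
  ultimately have "D o\<^sub>L (D o\<^sub>L D) = 0"
    using zero[OF A B sq D_def] by (metis D_def comp_simps(3) diff_self)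
  then have "D (D (D x)) = 0" for x
    by (metis blinfun.zero_left blinfun_apply_blinfun_compose)
  then have "D (D x) = 0" for x
    by (metis adjD inner_eq_zero_iff inner_zero_left sadj_inner)
  then have "D x = 0" for x
    by (metis adjD inner_eq_zero_iff inner_zero_left sadj_inner)
  then show ?thesis by (intro blinfun_eqI) (simp add: D_def blinfun.bilinear_simps)
qed

subsection \<open>The sign of a self-adjoint operator\<close>

lemma strong_limit:
  fixes X :: "nat \<Rightarrow> 'a::real_normed_vector \<Rightarrow>\<^sub>L 'b::real_normed_vector"
  assumes conv: "\<And>x. convergent (\<lambda>k. X k x)" and le: "\<And>k x. norm (X k x) \<le> norm x"
  obtains L :: "'a \<Rightarrow>\<^sub>L 'b" where "\<And>x. (\<lambda>k. X k x) \<longlonglongrightarrow> L x" "\<And>x. norm (L x) \<le> norm x"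
proof -
  define f where "f x = lim (\<lambda>k. X k x)" for x
  have f: "(\<lambda>k. X k x) \<longlonglongrightarrow> f x" for x
    using conv by (simp add: f_def convergent_LIMSEQ_iff)
  have nf: "norm (f x) \<le> norm x" for x
    using Lim_bounded[OF tendsto_norm[OF f[of x]], of 0] le by blast
  have "bounded_linear f"
  proof (rule bounded_linear_intro[where K = 1])
    show "f (x + y) = f x + f y" for x y
      using LIMSEQ_unique[OF f[of "x + y"]] tendsto_add[OF f[of x] f[of y]]
      by (simp add: blinfun.bilinear_simps)
    show "f (r *\<^sub>R x) = r *\<^sub>R f x" for r x
      using LIMSEQ_unique[OF f[of "r *\<^sub>R x"]] tendsto_scaleR[OF tendsto_const f[of x]]
      by (simp add: blinfun.bilinear_simps)
  qed (use nf in simp)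
  then have "blinfun_apply (Blinfun f) = f" by (rule bounded_linear_Blinfun_apply)
  then show thesis using that[of "Blinfun f"] f nf by simp
qed

text \<open>The uniform bound on \<open>X k\<close> permits an argument that moves with
  \<open>k\<close>. Applied repeatedly, this gives the strong limit of powers of
  \<open>X k\<close>.\<close>

lemma strong_limit_apply:
  fixes X :: "nat \<Rightarrow> 'a::real_normed_vector \<Rightarrow>\<^sub>L 'b::real_normed_vector"
  assumes "(\<lambda>k. X k y) \<longlonglongrightarrow> l" and le: "\<And>k x. norm (X k x) \<le> norm x"
    and y: "u \<longlonglongrightarrow> y"
  shows "(\<lambda>k. X k (u k)) \<longlonglongrightarrow> l"
proof -
  have "(\<lambda>k. X k (u k - y)) \<longlonglongrightarrow> 0"
  proof (rule Lim_null_comparison[OF always_eventually])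
    show "\<forall>k. norm (X k (u k - y)) \<le> norm (u k - y)" using le by blast
    show "(\<lambda>k. norm (u k - y)) \<longlonglongrightarrow> 0"
      using y by (simp add: LIM_zero tendsto_norm_zero)
  qed
  from tendsto_add[OF this assms(1)] show ?thesis by (simp add: blinfun.bilinear_simps)
qed

text \<open>The sign is the strong limit of the Newton-Schulz iteration \<open>X \<mapsto> X (3 - X\<^sup>2) / 2\<close>
  started at \<open>A\<close>. Convergence follows from \<open>(X\<^sub>k - X\<^sub>j)\<^sup>2 \<le> X\<^sub>k\<^sup>2 - X\<^sub>j\<^sup>2\<close> for \<open>j \<le> k\<close>, that is
  \<open>X\<^sub>j\<^sup>2 \<le> X\<^sub>k X\<^sub>j\<close>.\<close>

lemma sign_exists:
  fixes A :: "'a::{real_inner,banach} \<Rightarrow>\<^sub>L 'a"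
  assumes adjA: "adj A = A" and A1: "\<And>x. norm (A x) \<le> norm x"
  obtains X where "adj X = X" "\<And>x. X (X (X x)) = X x" "\<And>x. X x = 0 \<Longrightarrow> A x = 0"
    "\<And>x. 0 \<le> X (A x) \<bullet> x"
    "\<And>B C x. A o\<^sub>L B = C o\<^sub>L A \<Longrightarrow> A o\<^sub>L C = B o\<^sub>L A \<Longrightarrow> X (B x) = C (X x)"
proof -
  define X where "X = rec_nat A (\<lambda>_ C. (1/2) *\<^sub>R (3 *\<^sub>R C - (C o\<^sub>L C o\<^sub>L C)))"
  have X0: "X 0 = A" and XS: "X (Suc k) = (1/2) *\<^sub>R (3 *\<^sub>R X k - (X k o\<^sub>L X k o\<^sub>L X k))" for k
    by (simp_all add: X_def)
  have adjX: "adj (X k) = X k" for k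
    by (induction k) (simp_all add: X0 XS adjA comp_assoc)
  have sa: "X k u \<bullet> v = u \<bullet> X k v" for k u v using adjX sadj_inner by blast
  \<comment> \<open>The hypotheses are symmetric in \<open>B\<close> and \<open>C\<close>, and each
    factor \<open>X k\<close> swaps the two. The iteration is odd in \<open>X k\<close>, and three
    swaps amount to one.\<close>
  have inter: "X k (B x) = C (X k x) \<and> X k (C x) = B (X k x)"
    if "A o\<^sub>L B = C o\<^sub>L A" "A o\<^sub>L C = B o\<^sub>L A" for k x B C
  proof (induction k arbitrary: x)
    case 0
    show ?case using that comp_eq_iff unfolding X0 by metis
  next
    case (Suc k)
    then show ?case by (simp add: XS blinfun.bilinear_simps)
  qed
  have "X j o\<^sub>L A = A o\<^sub>L X j" for j using inter[of A A] by (simp add: comp_eq_iff)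
  then have comm: "X k (X j x) = X j (X k x)" for j k x using inter[of "X j" "X j"] by metis
  have D: "pos_op (id_blinfun - (X k o\<^sub>L X k))" for k
  proof (induction k)
    case 0
    have "A x \<bullet> A x \<le> x \<bullet> x" for x
      using A1[of x] by (simp add: norm_le)
    then show ?case
      by (simp add: pos_op_def X0 adjA blinfun.bilinear_simps inner_diff_left sadj_inner)
  next
    case (Suc k)
    define E where "E = id_blinfun - (X k o\<^sub>L X k)"
    have E: "pos_op E" using Suc by (simp add: E_def)
    have id: "pos_op id_blinfun" by (simp add: pos_op_def)
    \<comment> \<open>Put \<open>X k^2 = 1 - E\<close> into the square of
      \<open>X k (3 - X k^2) / 2\<close>. Pairing with an arbitrary \<open>v\<close> reduces the
      operator identity to one between reals.\<close>
    have "id_blinfun - (X (Suc k) o\<^sub>L X (Suc k)) = (1/4) *\<^sub>R (E o\<^sub>L E o\<^sub>L (3 *\<^sub>R id_blinfun + E))"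
    proof (rule blinfun_eqI, rule vector_eq_ldot[THEN iffD1], rule allI)
      show "v \<bullet> (id_blinfun - (X (Suc k) o\<^sub>L X (Suc k))) x
          = v \<bullet> ((1/4) *\<^sub>R (E o\<^sub>L E o\<^sub>L (3 *\<^sub>R id_blinfun + E))) x" for v x
        by (simp add: E_def XS blinfun.bilinear_simps inner_simps field_simps)
    qed
    moreover have "pos_op (E o\<^sub>L E o\<^sub>L (3 *\<^sub>R id_blinfun + E))"
      using E by (intro pos_op_conj pos_op_add pos_op_scaleR id)
        (simp_all add: pos_op_def comp_simps)
    ultimately show ?case by (simp add: pos_op_scaleR)
  qed
  have nX: "norm (X k x) \<le> norm x" for k x
  proof -
    have "X k (X k x) \<bullet> x \<le> x \<bullet> x"
      using D[of k] by (simp add: pos_op_def blinfun.bilinear_simps inner_diff_left)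
    then show ?thesis by (simp add: norm_le sa)
  qed
  have mono: "pos_op ((X k o\<^sub>L X j) - (X j o\<^sub>L X j))" if "j \<le> k" for j k
    using that
  proof (induction k rule: dec_induct)
    case base
    show ?case by (simp add: pos_op_def)
  next
    case (step k)
    \<comment> \<open>The increment of \<open>X k X j\<close> is half of
      \<open>X k X j (1 - X k^2)\<close>. Its first factor is positive because it is at least
      \<open>X j^2\<close>, the second by \<open>D\<close>, and commuting positive operators have a
      positive product.\<close>
    have "pos_op (X k o\<^sub>L X j)"
      using pos_op_add[OF step.IH pos_op_square[OF adjX[of j]]] by simp
    then have "pos_op ((X k o\<^sub>L X j) o\<^sub>L (id_blinfun - (X k o\<^sub>L X k)))"
      by (rule pos_op_comp[OF _ D]) (simp add: comp_eq_iff blinfun.bilinear_simps comm)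
    then have "pos_op (((X k o\<^sub>L X j) - (X j o\<^sub>L X j))
        + (1/2) *\<^sub>R ((X k o\<^sub>L X j) o\<^sub>L (id_blinfun - (X k o\<^sub>L X k))))"
      by (intro pos_op_add step.IH pos_op_scaleR) auto
    also have "((X k o\<^sub>L X j) - (X j o\<^sub>L X j))
        + (1/2) *\<^sub>R ((X k o\<^sub>L X j) o\<^sub>L (id_blinfun - (X k o\<^sub>L X k)))
        = (X (Suc k) o\<^sub>L X j) - (X j o\<^sub>L X j)"
    proof (rule blinfun_eqI, rule vector_eq_ldot[THEN iffD1], rule allI)
      show "v \<bullet> (((X k o\<^sub>L X j) - (X j o\<^sub>L X j))
        + (1/2) *\<^sub>R ((X k o\<^sub>L X j) o\<^sub>L (id_blinfun - (X k o\<^sub>L X k)))) x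
          = v \<bullet> ((X (Suc k) o\<^sub>L X j) - (X j o\<^sub>L X j)) x" for v x
        by (simp add: XS blinfun.bilinear_simps inner_simps field_simps comm[of j k])
    qed
    finally show ?case .
  qed
  have diff: "(norm (X k x - X j x))\<^sup>2 \<le> (norm (X k x))\<^sup>2 - (norm (X j x))\<^sup>2" if "j \<le> k" for j k x
  proof -
    have "X j x \<bullet> X j x \<le> X k x \<bullet> X j x"
    proof -
      have "X j (X j x) \<bullet> x \<le> X k (X j x) \<bullet> x"
        using mono[OF that]
        by (simp add: pos_op_def blinfun.bilinear_simps inner_diff_left)
      then show ?thesis by (simp only: sa comm[of j k])
    qed
    then show ?thesis
      by (simp add: power2_norm_eq_inner inner_diff_left inner_diff_right inner_commute)
  qed
  have inc: "incseq (\<lambda>k. (norm (X k x))\<^sup>2)" for x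
    using diff by (intro monoI) (smt (verit) zero_le_power2)
  have conv: "convergent (\<lambda>k. X k x)" for x
  proof -
    have "convergent (\<lambda>k. (norm (X k x))\<^sup>2)"
      using incseq_convergent[OF inc, of x "(norm x)\<^sup>2"] nX
      by (metis convergent_def norm_ge_zero power_mono)
    then have C: "Cauchy (\<lambda>k. (norm (X k x))\<^sup>2)" by (rule convergent_Cauchy)
    have "Cauchy (\<lambda>k. X k x)"
    proof (rule CauchyI')
      fix e :: real assume "0 < e"
      then obtain M where M: "\<And>m n. m \<ge> M \<Longrightarrow> n \<ge> M \<Longrightarrow>
          dist ((norm (X m x))\<^sup>2) ((norm (X n x))\<^sup>2) < e\<^sup>2"
        using metric_CauchyD[OF C, of "e\<^sup>2"] by auto
      have "dist (X m x) (X n x) < e" if "m \<ge> M" "n > m" for m n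
      proof -
        have "(norm (X n x - X m x))\<^sup>2 < e\<^sup>2"
          using diff[of m n x] M[of n m] that by (simp add: dist_real_def)
        then have "norm (X n x - X m x) < e"
          by (rule power_less_imp_less_base) (use \<open>0 < e\<close> in simp)
        then show ?thesis by (simp add: dist_norm norm_minus_commute)
      qed
      then show "\<exists>M. \<forall>m\<ge>M. \<forall>n>m. dist (X m x) (X n x) < e" by blast
    qed
    then show ?thesis by (rule Cauchy_convergent)
  qed
  obtain L :: "'a \<Rightarrow>\<^sub>L 'a" where L: "\<And>x. (\<lambda>k. X k x) \<longlonglongrightarrow> L x"
    by (rule strong_limit[OF conv nX]) (rule that)
  show thesis
  proof (rule that[of L])
    have "L x \<bullet> y = x \<bullet> L y" for x y
      using LIMSEQ_unique[OF tendsto_inner[OF L[of x] tendsto_const[of y]]]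
        tendsto_inner[OF tendsto_const[of x] L[of y]] sa by simp
    then show "adj L = L" by (simp add: adj_eq_iff)
    show "L (L (L x)) = L x" for x
    proof -
      have "(\<lambda>k. X k (X k (X k x))) \<longlonglongrightarrow> L (L (L x))"
        by (intro strong_limit_apply[OF L nX] L)
      then have "(\<lambda>k. (1/2) *\<^sub>R (3 *\<^sub>R X k x - X k (X k (X k x)))) \<longlonglongrightarrow>
          (1/2) *\<^sub>R (3 *\<^sub>R L x - L (L (L x)))"
        by (intro tendsto_scaleR tendsto_diff tendsto_const L)
      then have "(\<lambda>k. X (Suc k) x) \<longlonglongrightarrow> (1/2) *\<^sub>R (3 *\<^sub>R L x - L (L (L x)))"
        by (simp add: XS blinfun.bilinear_simps)
      moreover have "(\<lambda>k. X (Suc k) x) \<longlonglongrightarrow> L x" by (rule LIMSEQ_Suc[OF L])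
      ultimately have e: "(1/2) *\<^sub>R (3 *\<^sub>R L x - L (L (L x))) = L x" by (rule LIMSEQ_unique)
      have "L (L (L x)) = 3 *\<^sub>R L x - 2 *\<^sub>R ((1/2) *\<^sub>R (3 *\<^sub>R L x - L (L (L x))))" by simp
      also have "\<dots> = 3 *\<^sub>R L x - 2 *\<^sub>R L x" by (simp only: e)
      also have "\<dots> = L x" by (simp flip: scaleR_left.diff)
      finally show ?thesis .
    qed
    show "A x = 0" if "L x = 0" for x
    proof -
      \<comment> \<open>The norms increase with \<open>k\<close>, from that of \<open>A x\<close> to
        that of \<open>L x\<close>.\<close>
      have "(\<lambda>k. (norm (X k x))\<^sup>2) \<longlonglongrightarrow> (norm (L x))\<^sup>2" by (intro tendsto_intros L)
      from incseq_le[OF inc this, of 0] that show ?thesis by (simp add: X0)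
    qed
    show "0 \<le> L (A x) \<bullet> x" for x
    proof (rule tendsto_lowerbound)
      show "(\<lambda>k. X k (A x) \<bullet> x) \<longlonglongrightarrow> L (A x) \<bullet> x" by (intro tendsto_intros L)
      have "0 \<le> X k (X 0 x) \<bullet> x" for k
        using mono[of 0 k] pos_op_square[OF adjX[of 0]]
        by (simp add: pos_op_def blinfun.bilinear_simps inner_diff_left) (smt (verit))
      then show "\<forall>\<^sub>F k in sequentially. 0 \<le> X k (A x) \<bullet> x" by (simp add: X0)
    qed simp
    show "L (B x) = C (L x)" if "A o\<^sub>L B = C o\<^sub>L A" "A o\<^sub>L C = B o\<^sub>L A" for B C x
    proof -
      have "(\<lambda>k. C (X k x)) \<longlonglongrightarrow> C (L x)" by (intro blinfun.tendsto tendsto_const L)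
      then show ?thesis using LIMSEQ_unique[OF L[of "B x"]] inter[OF that] by simp
    qed
  qed
qed

subsection \<open>Midpoints in the Lagrangian Grassmannian\<close>

lemma grassmannianD:
  assumes "\<epsilon> \<in> grassmannian"
  shows "adj \<epsilon> = \<epsilon>" "\<epsilon> (\<epsilon> x) = x" "norm (\<epsilon> x) = norm x" "\<epsilon> x \<bullet> y = x \<bullet> \<epsilon> y"
proof -
  show a: "adj \<epsilon> = \<epsilon>" using assms by (simp add: grassmannian_def)
  have s: "\<epsilon> o\<^sub>L \<epsilon> = id_blinfun" using assms by (simp add: grassmannian_def)
  then show "\<epsilon> (\<epsilon> x) = x" by (metis blinfun_apply_blinfun_compose blinfun_apply_id_blinfun)
  show "norm (\<epsilon> x) = norm x" using a s by (intro norm_orthogonal) simp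
  show "\<epsilon> x \<bullet> y = x \<bullet> \<epsilon> y" using a by (rule sadj_inner)
qed

lemma lagrangian_grassmannianD:
  assumes "\<epsilon> \<in> lagrangian_grassmannian J"
  shows "\<epsilon> \<in> grassmannian" "\<epsilon> (J x) = - J (\<epsilon> x)"
  using assms
  by (auto simp: lagrangian_grassmannian_def blinfun.minus_left
      simp flip: blinfun_apply_blinfun_compose)

text \<open>The midpoint is the sign of \<open>\<epsilon>\<^sub>0 + \<epsilon>\<^sub>1\<close>, completed on \<open>N = ker (\<epsilon>\<^sub>0 + \<epsilon>\<^sub>1)\<close> by \<open>J \<epsilon>\<^sub>0\<close>. This
  choice on \<open>N\<close> is possible since \<open>J\<close> is a complex structure on \<open>N\<close> that anticommutes
  with \<open>\<epsilon>\<^sub>0\<close>.\<close>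

lemma lagrangian_midpoint:
  assumes J: "complex_structure J"
    and e0: "\<epsilon>\<^sub>0 \<in> lagrangian_grassmannian J" and e1: "\<epsilon>\<^sub>1 \<in> lagrangian_grassmannian J"
  obtains \<epsilon> where "\<epsilon> \<in> lagrangian_grassmannian J" "\<epsilon> o\<^sub>L \<epsilon>\<^sub>0 o\<^sub>L \<epsilon> = \<epsilon>\<^sub>1" "\<And>x. 0 \<le> \<epsilon> (\<epsilon>\<^sub>0 x) \<bullet> x"
proof -
  note g0 = grassmannianD[OF lagrangian_grassmannianD(1)[OF e0]]
  note g1 = grassmannianD[OF lagrangian_grassmannianD(1)[OF e1]]
  note eJ = lagrangian_grassmannianD(2)[OF e0] lagrangian_grassmannianD(2)[OF e1]
  have adjJ: "adj J = - J" and "J o\<^sub>L J = - id_blinfun"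
    using J by (auto simp: complex_structure_def)
  then have JJ: "J (J x) = - x" for x
    by (metis blinfun.minus_left blinfun_apply_blinfun_compose blinfun_apply_id_blinfun)
  define A where "A = (1/2) *\<^sub>R (\<epsilon>\<^sub>0 + \<epsilon>\<^sub>1)"
  have adjA: "adj A = A" by (simp add: A_def g0 g1)
  have A1: "norm (A x) \<le> norm x" for x
    using norm_triangle_ineq[of "\<epsilon>\<^sub>0 x" "\<epsilon>\<^sub>1 x"]
    by (simp add: A_def blinfun.bilinear_simps g0 g1)
  obtain X where adjX: "adj X = X" and XXX: "\<And>x. X (X (X x)) = X x"
    and ker: "\<And>x. X x = 0 \<Longrightarrow> A x = 0" and pos: "\<And>x. 0 \<le> X (A x) \<bullet> x"
    and inter: "\<And>B C x. A o\<^sub>L B = C o\<^sub>L A \<Longrightarrow> A o\<^sub>L C = B o\<^sub>L A \<Longrightarrow> X (B x) = C (X x)"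
    using sign_exists[OF adjA A1] by blast
  \<comment> \<open>\<open>A\<close> intertwines \<open>\<epsilon>\<^sub>0\<close> with
    \<open>\<epsilon>\<^sub>1\<close> in both directions, since both square to 1, and it
    anticommutes with \<open>J\<close>. The sign inherits these relations.\<close>
  have Xe0: "X (\<epsilon>\<^sub>0 x) = \<epsilon>\<^sub>1 (X x)" for x
    by (rule inter) (simp_all add: comp_eq_iff A_def blinfun.bilinear_simps g0 g1)
  have Xe1: "X (\<epsilon>\<^sub>1 x) = \<epsilon>\<^sub>0 (X x)" for x
    by (rule inter) (simp_all add: comp_eq_iff A_def blinfun.bilinear_simps g0 g1)
  have XJ: "X (J x) = - J (X x)" for x
    using inter[of J "- J" x] by (simp add: comp_eq_iff A_def blinfun.bilinear_simps eJ algebra_simps)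
  \<comment> \<open>By \<open>X^3 = X\<close>, the operator \<open>1 - X^2\<close> projects
    orthogonally onto the kernel of \<open>X\<close>. This kernel lies in that of \<open>A\<close>,
    where \<open>\<epsilon>\<^sub>1 = - \<epsilon>\<^sub>0\<close>.\<close>
  have "A (x - X (X x)) = 0" for x
    by (rule ker) (simp add: blinfun.bilinear_simps XXX)
  then have "\<epsilon>\<^sub>0 (x - X (X x)) + \<epsilon>\<^sub>1 (x - X (X x)) = 0" for x
    by (simp add: A_def blinfun.add_left blinfun.scaleR_left)
  then have e1X: "\<epsilon>\<^sub>1 (X (X x)) = \<epsilon>\<^sub>1 x + \<epsilon>\<^sub>0 x - \<epsilon>\<^sub>0 (X (X x))" for x
    by (simp add: blinfun.bilinear_simps algebra_simps)
  have e1X0: "\<epsilon>\<^sub>1 (\<epsilon>\<^sub>0 (X (X x))) = \<epsilon>\<^sub>1 (\<epsilon>\<^sub>0 x) + x - X (X x)" for x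
    using e1X[of "\<epsilon>\<^sub>0 x"] by (simp add: Xe0 Xe1 g0)
  note simps = blinfun.bilinear_simps XXX Xe0 Xe1 XJ eJ JJ g0(2) g1(2) e1X e1X0
  define \<epsilon> where "\<epsilon> = X + (J o\<^sub>L \<epsilon>\<^sub>0 o\<^sub>L (id_blinfun - (X o\<^sub>L X)))"
  show thesis
  proof (rule that[of \<epsilon>])
    have "adj \<epsilon> = \<epsilon>"
      by (rule blinfun_eqI) (simp add: \<epsilon>_def adjX adjJ g0(1) simps)
    moreover have "\<epsilon> o\<^sub>L \<epsilon> = id_blinfun"
      by (rule blinfun_eqI) (simp add: \<epsilon>_def simps)
    moreover have "\<epsilon> o\<^sub>L J = - (J o\<^sub>L \<epsilon>)"
      by (rule blinfun_eqI) (simp add: \<epsilon>_def simps)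
    ultimately show "\<epsilon> \<in> lagrangian_grassmannian J"
      by (simp add: lagrangian_grassmannian_def grassmannian_def)
    show "\<epsilon> o\<^sub>L \<epsilon>\<^sub>0 o\<^sub>L \<epsilon> = \<epsilon>\<^sub>1"
      by (rule blinfun_eqI) (simp add: \<epsilon>_def simps)
    show "0 \<le> \<epsilon> (\<epsilon>\<^sub>0 x) \<bullet> x" for x
    proof -
      define n where "n = x - X (X x)"
      have Jsk: "J u \<bullet> v = - (u \<bullet> J v)" for u v
        using adj_inner[of J u v] by (simp add: adjJ blinfun.bilinear_simps)
      have sX: "X u \<bullet> v = u \<bullet> X v" for u v using adjX by (rule sadj_inner)
      \<comment> \<open>\<open>J\<close> is skew and commutes with the projection
        \<open>1 - X^2\<close>, so the completion on the kernel adds nothing to the real part of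
        \<open>\<epsilon> \<epsilon>\<^sub>0\<close>.\<close>
      have "J n \<bullet> x = - (J x \<bullet> n)"
        by (metis Jsk inner_commute)
      also have "J x \<bullet> n = J n \<bullet> x"
        using sX[of "X (J x)" x] sX[of "J x" "X x"]
        by (simp add: n_def simps inner_simps)
      finally have "J n \<bullet> x = 0" by simp
      moreover have "\<epsilon> (\<epsilon>\<^sub>0 x) = X (\<epsilon>\<^sub>0 x) + J n" by (simp add: \<epsilon>_def n_def simps)
      moreover have "X (\<epsilon>\<^sub>0 x) \<bullet> x = X (A x) \<bullet> x"
      proof -
        \<comment> \<open>By \<open>X \<epsilon>\<^sub>0 = \<epsilon>\<^sub>1 X\<close>, the
          operator \<open>X \<epsilon>\<^sub>0\<close> is the adjoint of
          \<open>X \<epsilon>\<^sub>1\<close>. Both have the same quadratic form, which is then that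
          of their mean \<open>X A\<close>.\<close>
        have "X (\<epsilon>\<^sub>0 x) \<bullet> x = X (\<epsilon>\<^sub>1 x) \<bullet> x"
          by (metis Xe1 g0(4) inner_commute sX)
        then show ?thesis by (simp add: A_def blinfun.bilinear_simps inner_simps)
      qed
      ultimately show ?thesis using pos[of x] by (simp add: inner_simps)
    qed
  qed
qed

subsection \<open>The operator exponential\<close>

lemma norm_comp_funpow_le:
  "norm (((o\<^sub>L) A ^^ n) id_blinfun) \<le> norm (A :: 'a::real_normed_vector \<Rightarrow>\<^sub>L 'a) ^ n"
proof (induction n)
  case (Suc n)
  have "norm (((o\<^sub>L) A ^^ Suc n) id_blinfun) \<le> norm A * norm (((o\<^sub>L) A ^^ n) id_blinfun)"
    by (simp add: norm_blinfun_compose)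
  then show ?case using Suc by (simp add: mult_left_mono order_trans)
qed (simp add: norm_blinfun_id_le)

lemma comp_funpow_scaleR:
  fixes A :: "'a::real_normed_vector \<Rightarrow>\<^sub>L 'a"
  shows "((o\<^sub>L) (t *\<^sub>R A) ^^ n) id_blinfun = t ^ n *\<^sub>R ((o\<^sub>L) A ^^ n) id_blinfun"
  by (induction n) (simp_all add: comp_simps)

lemma comp_funpow_intertwine:
  fixes A :: "'a::real_normed_vector \<Rightarrow>\<^sub>L 'a" and C :: "'b::real_normed_vector \<Rightarrow>\<^sub>L 'b"
  assumes "A o\<^sub>L B = B o\<^sub>L C"
  shows "((o\<^sub>L) A ^^ n) id_blinfun o\<^sub>L B = B o\<^sub>L ((o\<^sub>L) C ^^ n) id_blinfun"
proof (induction n)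
  case (Suc n)
  have "((o\<^sub>L) A ^^ Suc n) id_blinfun o\<^sub>L B = A o\<^sub>L (B o\<^sub>L ((o\<^sub>L) C ^^ n) id_blinfun)"
    by (simp add: comp_assoc Suc)
  also have "\<dots> = B o\<^sub>L ((o\<^sub>L) C ^^ Suc n) id_blinfun"
    by (simp add: assms flip: comp_assoc)
  finally show ?case .
qed simp

lemma exp_op_sums: "(\<lambda>n. (1 / fact n) *\<^sub>R (((o\<^sub>L) A ^^ n) id_blinfun)) sums exp_op A"
  unfolding exp_op_def
proof (rule summable_sums, rule summable_norm_cancel, rule summable_comparison_test')
  show "summable (\<lambda>n. inverse (fact n) * norm A ^ n)" by (rule summable_exp)
  show "norm (norm ((1 / fact n) *\<^sub>R (((o\<^sub>L) A ^^ n) id_blinfun))) \<le> inverse (fact n) * norm A ^ n"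
    for n
    using norm_comp_funpow_le[where A = A and n = n] by (simp add: divide_inverse mult_left_mono)
qed

text \<open>Two exponents \<open>A\<close> and \<open>C\<close> cover commutation
  (\<open>C = A\<close>), as with \<open>J\<close>, as well as anticommutation
  (\<open>C = - A\<close>), which turns \<open>e^A\<close> into \<open>e^(-A)\<close>.\<close>

lemma exp_op_intertwine:
  assumes "A o\<^sub>L B = B o\<^sub>L C"
  shows "exp_op A o\<^sub>L B = B o\<^sub>L exp_op C"
proof (rule sums_unique2)
  show "(\<lambda>n. ((1 / fact n) *\<^sub>R (((o\<^sub>L) A ^^ n) id_blinfun)) o\<^sub>L B) sums (exp_op A o\<^sub>L B)"
    by (intro bounded_linear.sums[OF bounded_bilinear.bounded_linear_left[OF
      bounded_bilinear_blinfun_compose]] exp_op_sums)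
  have "(\<lambda>n. B o\<^sub>L ((1 / fact n) *\<^sub>R (((o\<^sub>L) C ^^ n) id_blinfun))) sums (B o\<^sub>L exp_op C)"
    by (intro bounded_linear.sums[OF bounded_bilinear.bounded_linear_right[OF
      bounded_bilinear_blinfun_compose]] exp_op_sums)
  then show "(\<lambda>n. ((1 / fact n) *\<^sub>R (((o\<^sub>L) A ^^ n) id_blinfun)) o\<^sub>L B) sums (B o\<^sub>L exp_op C)"
    by (simp add: comp_simps comp_funpow_intertwine[OF assms])
qed

lemma bounded_linear_adj: "bounded_linear adj"
  by (rule bounded_linear_intro[where K = 1]) simp_all

lemma adj_exp_op: "adj (exp_op A) = exp_op (adj A)"
proof (rule sums_unique2)
  show "(\<lambda>n. adj ((1 / fact n) *\<^sub>R (((o\<^sub>L) A ^^ n) id_blinfun))) sums adj (exp_op A)"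
    by (intro bounded_linear.sums[OF bounded_linear_adj] exp_op_sums)
  have "adj (((o\<^sub>L) A ^^ n) id_blinfun) = ((o\<^sub>L) (adj A) ^^ n) id_blinfun" for n
    by (induction n) (simp_all add: comp_funpow_intertwine)
  then show "(\<lambda>n. adj ((1 / fact n) *\<^sub>R (((o\<^sub>L) A ^^ n) id_blinfun))) sums exp_op (adj A)"
    using exp_op_sums[of "adj A"] by simp
qed

lemma exp_op_0 [simp]: "exp_op 0 = id_blinfun"
proof (rule sums_unique2[OF exp_op_sums])
  have "(\<lambda>n. (1 / fact n) *\<^sub>R (((o\<^sub>L) (0::'a \<Rightarrow>\<^sub>L 'a) ^^ n) id_blinfun))
      = (\<lambda>n. if n = 0 then id_blinfun else 0)"
  proof
    show "(1 / fact n) *\<^sub>R (((o\<^sub>L) (0::'a \<Rightarrow>\<^sub>L 'a) ^^ n) id_blinfun)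
      = (if n = 0 then id_blinfun else 0)" for n by (cases n) simp_all
  qed
  then show "(\<lambda>n. (1 / fact n) *\<^sub>R (((o\<^sub>L) (0::'a \<Rightarrow>\<^sub>L 'a) ^^ n) id_blinfun)) sums id_blinfun"
    using sums_single[of 0 "\<lambda>_. id_blinfun :: 'a \<Rightarrow>\<^sub>L 'a"] by simp
qed

lemma exp_op_has_vector_derivative:
  fixes z :: "'a::{real_inner,banach} \<Rightarrow>\<^sub>L 'a"
  shows "((\<lambda>t. exp_op (t *\<^sub>R z)) has_vector_derivative (z o\<^sub>L exp_op (t *\<^sub>R z))) (at t within T)"
proof -
  define P where "P n = ((o\<^sub>L) z ^^ n) id_blinfun" for n
  define f where "f n t = (t ^ n / fact n) *\<^sub>R P n" for n and t :: real
  define f' where "f' n t h = h *\<^sub>R ((real n * t ^ (n - 1) / fact n) *\<^sub>R P n)" for n and t h :: real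
  define R where "R = \<bar>t\<bar> + 1"
  define S where "S = {-R<..<R}"
  have PS: "P (Suc n) = z o\<^sub>L P n" for n by (simp add: P_def)
  have fs: "(\<lambda>n. f n t) sums exp_op (t *\<^sub>R z)" for t
    using exp_op_sums[of "t *\<^sub>R z"] by (simp add: comp_funpow_scaleR f_def P_def)
  \<comment> \<open>Differentiating a term lowers its degree by one, so the differentiated partial
    sum is \<open>z\<close> times the previous partial sum. Uniform convergence of the series itself
    then yields that of the derivatives.\<close>
  have partial: "(\<Sum>i<Suc n. f' i t h) = h *\<^sub>R (z o\<^sub>L (\<Sum>i<n. f i t))" for n t h
  proof (induction n)
    case 0
    show ?case by (simp add: f'_def)
  next
    case (Suc n)
    have "f' (Suc n) t h = h *\<^sub>R (z o\<^sub>L f n t)"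
      by (simp add: f'_def f_def PS comp_simps)
    then show ?case
      by (subst sum.lessThan_Suc, subst Suc) (simp add: comp_simps scaleR_right_distrib)
  qed
  have lim: "uniform_limit S (\<lambda>n t. \<Sum>i<n. f i t) (\<lambda>t. \<Sum>i. f i t) sequentially"
  proof (rule Weierstrass_m_test)
    show "norm (f n t) \<le> inverse (fact n) * (R * norm z) ^ n" if "t \<in> S" for n t
    proof -
      have "\<bar>t\<bar> ^ n * norm (P n) \<le> R ^ n * norm z ^ n"
        using that norm_comp_funpow_le[where A = z and n = n]
        by (intro mult_mono power_mono) (auto simp: S_def P_def R_def)
      then show ?thesis
        by (simp add: f_def power_mult_distrib divide_inverse abs_mult power_abs mult_ac)
    qed
    show "summable (\<lambda>n. inverse (fact n) * (R * norm z) ^ n)" by (rule summable_exp)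
  qed
  have "\<exists>g. \<forall>x\<in>S. (\<lambda>n. f n x) sums g x \<and>
      (g has_derivative (\<lambda>h. h *\<^sub>R (z o\<^sub>L exp_op (x *\<^sub>R z)))) (at x within S)"
  proof (rule has_derivative_series)
    show "convex S" by (simp add: S_def)
    show "(f n has_derivative f' n x) (at x within S)" for n x
      unfolding f_def f'_def by (auto intro!: derivative_eq_intros)
    show "\<forall>\<^sub>F n in sequentially. \<forall>x\<in>S. \<forall>h.
        norm ((\<Sum>i<n. f' i x h) - h *\<^sub>R (z o\<^sub>L exp_op (x *\<^sub>R z))) \<le> e * norm h" if "e > 0" for e
    proof -
      define d where "d = e / (norm z + 1)"
      have d: "d > 0" "norm z * d \<le> e"
        using that by (simp_all add: d_def add_nonneg_pos divide_simps add_pos_nonneg)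
      have "\<forall>\<^sub>F n in sequentially. \<forall>x\<in>S. dist (\<Sum>i<n. f i x) (\<Sum>i. f i x) < d"
        using lim d by (simp add: uniform_limit_iff)
      then have "\<forall>\<^sub>F n in sequentially. \<forall>x\<in>S. \<forall>h.
        norm ((\<Sum>i<Suc n. f' i x h) - h *\<^sub>R (z o\<^sub>L exp_op (x *\<^sub>R z))) \<le> e * norm h"
      proof eventually_elim
        case (elim n)
        show ?case
        proof (intro ballI allI)
          fix x h assume "x \<in> S"
          have "norm (z o\<^sub>L ((\<Sum>i<n. f i x) - exp_op (x *\<^sub>R z)))
              \<le> norm z * norm ((\<Sum>i<n. f i x) - exp_op (x *\<^sub>R z))"
            by (rule norm_blinfun_compose)
          also have "\<dots> \<le> norm z * d"
            using elim \<open>x \<in> S\<close> sums_unique[OF fs[of x]]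
            by (intro mult_left_mono) (auto simp: dist_norm less_imp_le)
          finally have "norm (z o\<^sub>L ((\<Sum>i<n. f i x) - exp_op (x *\<^sub>R z))) \<le> e" using d by simp
          then have "\<bar>h\<bar> * norm (z o\<^sub>L ((\<Sum>i<n. f i x) - exp_op (x *\<^sub>R z))) \<le> \<bar>h\<bar> * e"
            by (intro mult_left_mono) auto
          then show "norm ((\<Sum>i<Suc n. f' i x h) - h *\<^sub>R (z o\<^sub>L exp_op (x *\<^sub>R z))) \<le> e * norm h"
            unfolding partial by (simp add: comp_simps mult_ac flip: scaleR_diff_right)
        qed
      qed
      then show ?thesis by (subst (asm) eventually_sequentially_Suc)
    qed
    show "t \<in> S" by (auto simp: S_def R_def)
    show "(\<lambda>n. f n t) sums exp_op (t *\<^sub>R z)" by (rule fs)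
  qed
  then obtain g where g: "\<And>x. x \<in> S \<Longrightarrow> (\<lambda>n. f n x) sums g x"
    "\<And>x. x \<in> S \<Longrightarrow> (g has_derivative (\<lambda>h. h *\<^sub>R (z o\<^sub>L exp_op (x *\<^sub>R z)))) (at x within S)"
    by blast
  have t: "t \<in> S" by (auto simp: S_def R_def)
  have "((\<lambda>t. exp_op (t *\<^sub>R z)) has_derivative (\<lambda>h. h *\<^sub>R (z o\<^sub>L exp_op (t *\<^sub>R z)))) (at t within S)"
    by (rule has_derivative_transform[OF t _ g(2)[OF t]]) (use sums_unique2[OF fs g(1)] in blast)
  then have "((\<lambda>t. exp_op (t *\<^sub>R z)) has_derivative (\<lambda>h. h *\<^sub>R (z o\<^sub>L exp_op (t *\<^sub>R z)))) (at t)"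
    using t by (subst (asm) at_within_open) (auto simp: S_def)
  then show ?thesis
    unfolding has_vector_derivative_def by (rule has_derivative_at_withinI)
qed

lemma exp_op_comp_commute: "z o\<^sub>L exp_op (t *\<^sub>R z) = exp_op (t *\<^sub>R z) o\<^sub>L z"
  by (rule exp_op_intertwine[symmetric]) (simp add: comp_simps)

lemma exp_op_add_scaleR:
  fixes z :: "'a::{real_inner,banach} \<Rightarrow>\<^sub>L 'a"
  shows "exp_op ((s + t) *\<^sub>R z) = exp_op (s *\<^sub>R z) o\<^sub>L exp_op (t *\<^sub>R z)"
proof -
  define E where "E t = exp_op (t *\<^sub>R z)" for t
  \<comment> \<open>\<open>G\<close> joins the two sides, \<open>G 0\<close> and \<open>G t\<close>.
    Its derivative vanishes because \<open>z\<close> commutes with its exponentials.\<close>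
  define G where "G r = E (s + t - r) o\<^sub>L E r" for r
  have "(G has_vector_derivative 0) (at r within UNIV)" for r
  proof -
    have E: "(E has_vector_derivative (z o\<^sub>L E r)) (at r)" for r
      unfolding E_def by (rule exp_op_has_vector_derivative)
    have "((\<lambda>r. s + t - r) has_vector_derivative (0 - 1)) (at r)"
      by (intro derivative_intros)
    from vector_diff_chain_at[OF this E]
    have "((\<lambda>r. E (s + t - r)) has_vector_derivative - (z o\<^sub>L E (s + t - r))) (at r)"
      by (simp add: o_def)
    from bounded_bilinear.has_vector_derivative[OF bounded_bilinear_blinfun_compose this E]
    show ?thesis
      by (simp add: G_def[abs_def] comp_simps comp_assoc E_def exp_op_comp_commute)
  qed
  then have "G t = G 0"
    using has_vector_derivative_zero_constant[of UNIV G] by (metis UNIV_I convex_UNIV)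
  then show ?thesis by (simp add: G_def E_def)
qed

lemma exp_op_double:
  fixes z :: "'a::{real_inner,banach} \<Rightarrow>\<^sub>L 'a"
  shows "exp_op (2 *\<^sub>R z) = exp_op z o\<^sub>L exp_op z"
  using exp_op_add_scaleR[of 1 1 z] by simp

lemma exp_op_inverse:
  fixes z :: "'a::{real_inner,banach} \<Rightarrow>\<^sub>L 'a"
  shows "exp_op (- z) o\<^sub>L exp_op z = id_blinfun"
  using exp_op_add_scaleR[of "-1" 1 z] by simp

lemma exp_op_orthogonal:
  assumes "adj z = - z"
  shows "adj (exp_op z) = exp_op (- z)" "norm (exp_op z x) = norm x" "norm (exp_op z) \<le> 1"
proof -
  show a: "adj (exp_op z) = exp_op (- z)" by (simp add: adj_exp_op assms)
  show n: "norm (exp_op z x) = norm x" for x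
    by (rule norm_orthogonal) (simp add: a exp_op_inverse)
  show "norm (exp_op z) \<le> 1" by (rule norm_blinfun_bound) (simp_all add: n)
qed

text \<open>Skewness makes \<open>e^(t z)\<close> a contraction, so its derivative in
  \<open>t\<close> is bounded by the norm of \<open>z\<close>. Two applications of the mean value
  inequality give the constant 1 for \<open>z\<close> of any size.\<close>

lemma exp_op_remainder:
  fixes z :: "'a::{real_inner,banach} \<Rightarrow>\<^sub>L 'a"
  assumes "adj z = - z"
  shows "norm (exp_op z - id_blinfun - z) \<le> (norm z)\<^sup>2"
proof -
  have sk: "adj (t *\<^sub>R z) = - (t *\<^sub>R z)" for t by (simp add: assms)
  note der = exp_op_has_vector_derivative[of z, unfolded has_vector_derivative_def]
  have b: "norm (z o\<^sub>L exp_op (t *\<^sub>R z)) \<le> norm z" for t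
    using norm_blinfun_compose[of z "exp_op (t *\<^sub>R z)"] exp_op_orthogonal(3)[OF sk[of t]]
    by (smt (verit) mult_left_le norm_ge_zero)
  have step: "norm (exp_op (t *\<^sub>R z) - id_blinfun) \<le> norm z" if "t \<in> {0..1}" for t
  proof -
    have "norm (exp_op (t *\<^sub>R z) - exp_op (0 *\<^sub>R z)) \<le> norm z * norm (t - 0)"
    proof (rule differentiable_bound[of "{0..1}" _ "\<lambda>t h. h *\<^sub>R (z o\<^sub>L exp_op (t *\<^sub>R z))"])
      show "onorm (\<lambda>h. h *\<^sub>R (z o\<^sub>L exp_op (t *\<^sub>R z))) \<le> norm z" for t
        using b by (intro onorm_bound) (auto simp: mult.commute[of "norm z"] intro!: mult_left_mono)
    qed (use that der in auto)
    also have "\<dots> \<le> norm z" using that by (simp add: mult_left_le)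
    finally show ?thesis by simp
  qed
  have "norm (exp_op (1 *\<^sub>R z) - exp_op (0 *\<^sub>R z) - (1 - 0) *\<^sub>R (z o\<^sub>L exp_op (0 *\<^sub>R z)))
      \<le> norm (1 - 0 :: real) * (norm z)\<^sup>2"
  proof (rule vector_differentiable_bound_linearization[of "{0..1}"])
    show "((\<lambda>t. exp_op (t *\<^sub>R z)) has_vector_derivative z o\<^sub>L exp_op (t *\<^sub>R z)) (at t within {0..1})"
      for t by (rule exp_op_has_vector_derivative)
    show "norm ((z o\<^sub>L exp_op (t *\<^sub>R z)) - (z o\<^sub>L exp_op (0 *\<^sub>R z))) \<le> (norm z)\<^sup>2"
      if "t \<in> {0..1}" for t
    proof -
      have "(z o\<^sub>L exp_op (t *\<^sub>R z)) - (z o\<^sub>L exp_op (0 *\<^sub>R z))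
          = z o\<^sub>L (exp_op (t *\<^sub>R z) - id_blinfun)" by (simp add: comp_simps)
      then have "norm ((z o\<^sub>L exp_op (t *\<^sub>R z)) - (z o\<^sub>L exp_op (0 *\<^sub>R z)))
          \<le> norm z * norm (exp_op (t *\<^sub>R z) - id_blinfun)"
        by (simp add: norm_blinfun_compose)
      also have "\<dots> \<le> norm z * norm z" by (intro mult_left_mono step that) simp
      finally show ?thesis by (simp add: power2_eq_square)
    qed
  qed (auto simp: closed_segment_eq_real_ivl)
  then show ?thesis by simp
qed

subsection \<open>Logarithms of orthogonal operators\<close>

lemma le_zero_if_le_divide_pow2:
  assumes "\<And>k. a \<le> K / 2 ^ k"
  shows "a \<le> (0::real)"
  using LIMSEQ_le_const[OF LIMSEQ_divide_realpow_zero[of 2 K], of a] assms by auto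

lemma four_power: "(4::real) ^ k = 2 ^ k * 2 ^ k"
  by (simp flip: power_mult_distrib)

text \<open>\<open>b\<close> is the largest lower bound of \<open>Re U\<close>. It improves to \<open>(b + (1 + c) / 2) / (1 + b)\<close>
  because of \<open>U\<^sup>2 - 1 = (U + 1) (U - 1)\<close>.\<close>

lemma half_angle_bound:
  fixes U :: "'a::{real_inner,banach} \<Rightarrow>\<^sub>L 'a"
  assumes iso: "\<And>x. norm (U x) = norm x" and pos: "\<And>x. 0 \<le> U x \<bullet> x"
    and c: "\<And>x. c * (x \<bullet> x) \<le> U (U x) \<bullet> x"
  shows "sqrt ((1 + c) / 2) * (x \<bullet> x) \<le> U x \<bullet> x"
proof (cases "x = 0")
  case False
  define q where "q y = (U y \<bullet> y) / (y \<bullet> y)" for y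
  define b where "b = (INF y \<in> - {0}. q y)"
  have bdd: "bdd_below (q ` (- {0}))"
    by (rule bdd_belowI2[where m = 0]) (simp add: q_def pos)
  have b0: "0 \<le> b" unfolding b_def
    using False by (intro cINF_greatest) (auto simp: q_def pos)
  have b: "b * (y \<bullet> y) \<le> U y \<bullet> y" for y
  proof (cases "y = 0")
    case False
    then have "b \<le> q y" unfolding b_def by (intro cINF_lower bdd) simp
    then show ?thesis using False by (simp add: q_def pos_le_divide_eq)
  qed simp
  have UU: "U y \<bullet> U y = y \<bullet> y" for y
    using iso[of y] by (simp add: norm_eq)
  \<comment> \<open>The bound \<open>b\<close> is applied not to \<open>y\<close> but to
    \<open>v = U y - y\<close>; the norm of \<open>U v + v = U^2 y - y\<close> is computed in two
    ways.\<close>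
  have key: "(1 + b) * (y \<bullet> y - U y \<bullet> y) \<le> (1 - c) / 2 * (y \<bullet> y)" for y
  proof -
    define v where "v = U y - y"
    have vv: "v \<bullet> v = 2 * (y \<bullet> y - U y \<bullet> y)"
      by (simp add: v_def inner_simps UU inner_commute)
    have "(U v + v) \<bullet> (U v + v) = 2 * (y \<bullet> y) - 2 * (U (U y) \<bullet> y)"
      by (simp add: v_def blinfun.bilinear_simps inner_simps UU inner_commute)
    moreover have "(U v + v) \<bullet> (U v + v) = 2 * (v \<bullet> v) + 2 * (U v \<bullet> v)"
      by (simp add: inner_simps UU inner_commute)
    ultimately have "v \<bullet> v + b * (v \<bullet> v) \<le> y \<bullet> y - c * (y \<bullet> y)" using b[of v] c[of y] by linarith
    then show ?thesis by (simp add: vv algebra_simps)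
  qed
  \<comment> \<open>By \<open>key\<close> every quotient satisfies the improved bound, hence so does
    the infimum \<open>b\<close>. Clearing the denominator leaves
    \<open>(1 + c) / 2 \<le> b^2\<close>, the half-angle formula.\<close>
  have "(b + (1 + c) / 2) / (1 + b) \<le> b"
  proof -
    have "(b + (1 + c) / 2) / (1 + b) \<le> q y" if "y \<noteq> 0" for y
    proof -
      have "(b + (1 + c) / 2) * (y \<bullet> y) \<le> (1 + b) * (U y \<bullet> y)"
      proof -
        have "(b + (1 + c) / 2) * (y \<bullet> y) = (1 + b) * (y \<bullet> y) - (1 - c) / 2 * (y \<bullet> y)"
          by (simp add: field_simps)
        also have "\<dots> \<le> (1 + b) * (y \<bullet> y) - (1 + b) * (y \<bullet> y - U y \<bullet> y)"
          using key[of y] by linarith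
        also have "\<dots> = (1 + b) * (U y \<bullet> y)" by (simp add: algebra_simps)
        finally show ?thesis .
      qed
      then have "(b + (1 + c) / 2) * (y \<bullet> y) \<le> ((1 + b) * q y) * (y \<bullet> y)"
        using that by (simp add: q_def)
      then have "b + (1 + c) / 2 \<le> (1 + b) * q y"
        by (rule mult_right_le_imp_le) (use that in simp)
      then show ?thesis using b0 by (simp add: pos_divide_le_eq mult.commute)
    qed
    then show ?thesis using False unfolding b_def by (intro cINF_greatest) auto
  qed
  then have "(1 + c) / 2 \<le> b\<^sup>2"
    using b0 by (simp add: divide_simps power2_eq_square algebra_simps split: if_splits)
  then have "sqrt ((1 + c) / 2) \<le> b" using b0 by (metis real_le_lsqrt)
  then have "sqrt ((1 + c) / 2) * (x \<bullet> x) \<le> b * (x \<bullet> x)" by (intro mult_right_mono) auto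
  then show ?thesis using b[of x] by linarith
qed simp

text \<open>The logarithm is the limit of \<open>2\<^sup>k Im W\<^sub>k\<close>. The half-angle bounds \<open>Re W\<^sub>k \<ge> cos (\<pi> / 2\<^sup>k\<^sup>+\<^sup>1)\<close>
  control the rate of convergence, and \<open>2\<^sup>k sin (\<pi> / 2\<^sup>k\<^sup>+\<^sup>1) \<le> \<pi> / 2\<close> bounds its norm.\<close>

lemma orthogonal_log_exists:
  fixes W :: "nat \<Rightarrow> 'a::{real_inner,banach} \<Rightarrow>\<^sub>L 'a"
  assumes orth: "\<And>k. adj (W k) o\<^sub>L W k = id_blinfun" "\<And>k. W k o\<^sub>L adj (W k) = id_blinfun"
    and sq: "\<And>k. W (Suc k) o\<^sub>L W (Suc k) = W k" and pos: "\<And>k x. 0 \<le> W k x \<bullet> x"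
  obtains z where "(\<lambda>k. (2 ^ k / 2) *\<^sub>R (W k - adj (W k))) \<longlonglongrightarrow> z" "adj z = - z"
    "norm z \<le> pi / 2" "exp_op z = W 0"
proof -
  \<comment> \<open>At \<open>k = 0\<close> the angle is \<open>pi / 2\<close> and
    \<open>c 0 = 0\<close>, so the lower bound by \<open>c\<close> starts from the hypothesis
    \<open>pos\<close>. Each square root halves the angle.\<close>
  define c where "c k = cos (pi / 2 ^ Suc k)" for k :: nat
  define Z where "Z k = (2 ^ k / 2) *\<^sub>R (W k - adj (W k))" for k
  have iso: "norm (W k x) = norm x" "norm (adj (W k) x) = norm x" for k x
    using orth by (auto intro: norm_orthogonal)
  have inner_iso: "W k x \<bullet> W k x = x \<bullet> x" "adj (W k) x \<bullet> adj (W k) x = x \<bullet> x" for k x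
    using iso by (simp_all add: norm_eq[symmetric])
  have angle: "0 \<le> pi / 2 ^ Suc k" "pi / 2 ^ Suc k \<le> pi / 2" for k
    by (simp_all add: divide_le_eq mult_le_cancel_left1)
  have c0: "0 \<le> c k" for k
    unfolding c_def using angle[of k] by (intro cos_ge_zero) linarith+
  have c_half: "(1 + c k) / 2 = (c (Suc k))\<^sup>2" for k
    using cos_double_cos[of "pi / 2 ^ Suc (Suc k)"] by (simp add: c_def)
  have low: "c k * (x \<bullet> x) \<le> W k x \<bullet> x" for k x
  proof (induction k arbitrary: x)
    case 0
    show ?case using pos[of 0 x] by (simp add: c_def)
  next
    case (Suc k)
    have "sqrt ((1 + c k) / 2) * (x \<bullet> x) \<le> W (Suc k) x \<bullet> x"
    proof (rule half_angle_bound[OF iso(1) pos])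
      show "c k * (x \<bullet> x) \<le> W (Suc k) (W (Suc k) x) \<bullet> x" for x
        using Suc[of x] sq[of k] by (metis blinfun_apply_blinfun_compose)
    qed
    then show ?case by (simp only: c_half real_sqrt_abs abs_of_nonneg[OF c0])
  qed
  \<comment> \<open>The identity \<open>2 - 2 cos \<theta> = (2 sin (\<theta> / 2))^2\<close>
    converts the bound on the real part into a distance; \<open>pi < 4\<close> rounds the constant
    to 2.\<close>
  have dW: "norm (W k - id_blinfun) \<le> 2 / 2 ^ k" for k
  proof -
    have "norm (W k - id_blinfun) \<le> 2 * sin (pi / 2 ^ Suc (Suc k))"
    proof (rule norm_blinfun_bound)
      show s0: "0 \<le> 2 * sin (pi / 2 ^ Suc (Suc k))"
        using angle[of "Suc k"] pi_gt_zero by (intro mult_nonneg_nonneg sin_ge_zero) linarith+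
      fix x
      have "(norm (W k x - x))\<^sup>2 = 2 * (x \<bullet> x) - 2 * (W k x \<bullet> x)"
        by (simp add: power2_norm_eq_inner inner_simps inner_iso inner_commute)
      also have "\<dots> \<le> (2 - 2 * c k) * (x \<bullet> x)" using low[of k x] by (simp add: algebra_simps)
      also have "2 - 2 * c k = (2 * sin (pi / 2 ^ Suc (Suc k)))\<^sup>2"
        using cos_double_sin[of "pi / 2 ^ Suc (Suc k)"] by (simp add: c_def power_mult_distrib)
      finally have "(norm (W k x - x))\<^sup>2 \<le> (2 * sin (pi / 2 ^ Suc (Suc k)) * norm x)\<^sup>2"
        by (simp add: power_mult_distrib power2_norm_eq_inner)
      then show "norm ((W k - id_blinfun) x) \<le> 2 * sin (pi / 2 ^ Suc (Suc k)) * norm x"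
        using s0 by (simp add: blinfun.bilinear_simps)
    qed
    also have "\<dots> \<le> 2 * (pi / 2 ^ Suc (Suc k))"
      by (intro mult_left_mono sin_x_le_x) auto
    also have "\<dots> \<le> 2 / 2 ^ k" using pi_less_4 by (simp add: divide_simps)
    finally show ?thesis .
  qed
  have dW': "norm (id_blinfun - W k) \<le> 2 / 2 ^ k" "norm (id_blinfun - adj (W k)) \<le> 2 / 2 ^ k" for k
    using dW[of k] norm_adj[of "W k - id_blinfun"] by (simp_all add: norm_minus_commute)
  have prod: "norm ((id_blinfun - W k) o\<^sub>L (id_blinfun - adj (W k))) \<le> 4 / 4 ^ k" for k
  proof -
    have "norm ((id_blinfun - W k) o\<^sub>L (id_blinfun - adj (W k))) \<le> (2 / 2 ^ k) * (2 / 2 ^ k)"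
      by (rule order_trans[OF norm_blinfun_compose]) (intro mult_mono dW', auto)
    then show ?thesis by (simp add: power_mult_distrib[symmetric])
  qed
  have Zn: "norm (Z k) \<le> pi / 2" for k
  proof -
    have s0: "0 \<le> sin (pi / 2 ^ Suc k)"
      using angle[of k] pi_gt_zero by (intro sin_ge_zero) linarith+
    have "norm (W k - adj (W k)) \<le> 2 * sin (pi / 2 ^ Suc k)"
    proof (rule norm_blinfun_bound)
      fix x
      define p where "p = W k x + adj (W k) x"
      define m where "m = W k x - adj (W k) x"
      \<comment> \<open>By the parallelogram law the squared norms of \<open>p\<close> and
        \<open>m\<close> add up to four times that of \<open>x\<close>. The lower bound on the real
        part forces \<open>p\<close> to be long, so \<open>m\<close> is short.\<close>
      have "2 * (c k * (x \<bullet> x)) \<le> p \<bullet> x"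
        using low[of k x] adj_inner'[of x "W k" x] by (simp add: p_def inner_simps inner_commute)
      also have "\<dots> \<le> norm p * norm x" by (rule norm_cauchy_schwarz)
      finally have "(2 * c k * norm x) * norm x \<le> norm p * norm x"
        by (simp add: power2_norm_eq_inner[symmetric] power2_eq_square mult_ac)
      then have "2 * c k * norm x \<le> norm p" by (cases "x = 0") auto
      then have "(2 * c k * norm x)\<^sup>2 \<le> (norm p)\<^sup>2" using c0 by (intro power_mono) auto
      moreover have "(norm p)\<^sup>2 + (norm m)\<^sup>2 = 4 * (norm x)\<^sup>2"
        by (simp add: p_def m_def power2_norm_eq_inner inner_simps inner_iso)
      ultimately have "(norm m)\<^sup>2 \<le> (4 - 4 * (c k)\<^sup>2) * (norm x)\<^sup>2"
        by (simp add: power_mult_distrib algebra_simps)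
      also have "\<dots> = (2 * sin (pi / 2 ^ Suc k) * norm x)\<^sup>2"
        by (simp add: power_mult_distrib c_def sin_squared_eq algebra_simps)
      finally have "norm m \<le> 2 * sin (pi / 2 ^ Suc k) * norm x"
        using s0 by (meson mult_nonneg_nonneg norm_ge_zero power2_le_imp_le zero_le_numeral)
      then show "norm ((W k - adj (W k)) x) \<le> 2 * sin (pi / 2 ^ Suc k) * norm x"
        by (simp add: m_def blinfun.bilinear_simps)
    qed (use s0 in simp)
    also have "\<dots> \<le> 2 * (pi / 2 ^ Suc k)" by (intro mult_left_mono sin_x_le_x) auto
    finally have "(2 ^ k / 2) * norm (W k - adj (W k)) \<le> (2 ^ k / 2) * (2 * (pi / 2 ^ Suc k))"
      by (rule mult_left_mono) simp
    then show ?thesis by (simp add: Z_def)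
  qed
  have W_adj: "adj (W (Suc k)) o\<^sub>L adj (W (Suc k)) = adj (W k)" for k
    using sq[of k] by (metis adj_comp)
  have Zd: "norm (Z (Suc k) - Z k) \<le> 1 / 2 ^ k" for k
  proof -
    define U where "U = W (Suc k)"
    \<comment> \<open>Operator form of \<open>2 sin \<theta> - sin (2 \<theta>) = 2 sin \<theta> (1
      - cos \<theta>)\<close>. The second factor is of order \<open>4^(-k)\<close>, which outweighs
      the factor \<open>2^k\<close> in \<open>Z k\<close>.\<close>
    have "(U - adj U) o\<^sub>L ((id_blinfun - U) o\<^sub>L (id_blinfun - adj U))
        = 2 *\<^sub>R (U - adj U) - (W k - adj (W k))"
      by (simp add: U_def comp_simps orth sq W_adj scaleR_2 comp_assoc)
    then have "Z (Suc k) - Z k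
        = (2 ^ k / 2) *\<^sub>R ((U - adj U) o\<^sub>L ((id_blinfun - U) o\<^sub>L (id_blinfun - adj U)))"
      by (simp add: Z_def U_def scaleR_diff_right)
    then have "norm (Z (Suc k) - Z k)
        = (2 ^ k / 2) * norm ((U - adj U) o\<^sub>L ((id_blinfun - U) o\<^sub>L (id_blinfun - adj U)))"
      by simp
    also have "\<dots> \<le> (2 ^ k / 2) * (2 * (4 / 4 ^ Suc k))"
    proof (rule mult_left_mono, rule order_trans[OF norm_blinfun_compose], rule mult_mono)
      show "norm (U - adj U) \<le> 2"
      proof -
        have "norm U \<le> 1" unfolding U_def by (rule norm_blinfun_bound) (simp_all add: iso)
        then show ?thesis using norm_triangle_ineq4[of U "adj U"] by simp
      qed
      show "norm ((id_blinfun - U) o\<^sub>L (id_blinfun - adj U)) \<le> 4 / 4 ^ Suc k"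
        unfolding U_def by (rule prod)
    qed auto
    also have "\<dots> = 1 / 2 ^ k"
      by (simp add: four_power)
    finally show ?thesis .
  qed
  have tele: "norm (Z (k + n) - Z k) \<le> 2 / 2 ^ k - 2 / 2 ^ (k + n)" for k n
  proof (induction n)
    case (Suc n)
    have "norm (Z (k + Suc n) - Z k) \<le> norm (Z (Suc (k + n)) - Z (k + n)) + norm (Z (k + n) - Z k)"
      using norm_triangle_ineq[of "Z (Suc (k + n)) - Z (k + n)" "Z (k + n) - Z k"] by simp
    also have "\<dots> \<le> 1 / 2 ^ (k + n) + (2 / 2 ^ k - 2 / 2 ^ (k + n))"
      by (intro add_mono Zd Suc)
    finally show ?case by (simp add: field_simps)
  qed simp
  have bound: "norm (Z (k + n) - Z k) \<le> 2 / 2 ^ k" for k n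
    using tele[of k n] by (smt (verit) zero_le_divide_iff zero_le_power)
  have "Cauchy Z"
  proof (rule CauchyI')
    fix e :: real assume "0 < e"
    then have "\<forall>\<^sub>F k in sequentially. 2 / 2 ^ k < e"
      using order_tendstoD(2)[OF LIMSEQ_divide_realpow_zero[of 2 2]] by simp
    then obtain M where M: "\<And>k. k \<ge> M \<Longrightarrow> 2 / 2 ^ k < e"
      by (auto simp: eventually_sequentially)
    have "dist (Z m) (Z n) < e" if "m \<ge> M" "n > m" for m n
    proof -
      have "norm (Z (m + (n - m)) - Z m) \<le> 2 / 2 ^ m" by (rule bound)
      then show ?thesis using that M[of m] by (simp add: dist_norm norm_minus_commute)
    qed
    then show "\<exists>M. \<forall>m\<ge>M. \<forall>n>m. dist (Z m) (Z n) < e" by blast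
  qed
  then obtain z where z: "Z \<longlonglongrightarrow> z" using Cauchy_convergent convergent_def by blast
  have zZ: "norm (z - Z k) \<le> 2 / 2 ^ k" for k
  proof (rule Lim_bounded[of "\<lambda>n. norm (Z (k + n) - Z k)" _ 0])
    have "(\<lambda>n. Z (n + k)) \<longlonglongrightarrow> z" by (rule LIMSEQ_ignore_initial_segment[OF z])
    then show "(\<lambda>n. norm (Z (k + n) - Z k)) \<longlonglongrightarrow> norm (z - Z k)"
      by (intro tendsto_norm tendsto_diff tendsto_const) (simp add: add.commute)
  qed (use bound in blast)
  have nz: "norm z \<le> pi / 2"
    using Lim_bounded[OF tendsto_norm[OF z], of 0] Zn by blast
  have skew: "adj z = - z"
  proof (rule LIMSEQ_unique)
    show "(\<lambda>k. adj (Z k)) \<longlonglongrightarrow> adj z" by (rule bounded_linear.tendsto[OF bounded_linear_adj z])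
    have "adj (Z k) = - Z k" for k by (simp add: Z_def flip: scaleR_minus_right)
    then show "(\<lambda>k. adj (Z k)) \<longlonglongrightarrow> - z" using tendsto_minus[OF z] by simp
  qed
  \<comment> \<open>The iterated roots \<open>E k\<close> of \<open>e^z\<close> differ from
    \<open>W k\<close> by at most \<open>8 / 4^k\<close>, while squaring at most doubles the
    distance. Going back from level \<open>k\<close> to level 0 gives the bound
    \<open>8 / 2^k\<close>, which tends to 0.\<close>
  define E where "E k = exp_op ((1 / 2 ^ k) *\<^sub>R z)" for k :: nat
  have E_sq: "E (Suc k) o\<^sub>L E (Suc k) = E k" for k
    using exp_op_double[of "(1 / 2 ^ Suc k) *\<^sub>R z"] by (simp add: E_def)
  have sk: "adj (r *\<^sub>R z) = - (r *\<^sub>R z)" for r by (simp add: skew)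
  have nE: "norm (E k) \<le> 1" for k unfolding E_def by (rule exp_op_orthogonal(3)[OF sk])
  have nW: "norm (W k) \<le> 1" for k by (rule norm_blinfun_bound) (simp_all add: iso)
  have near: "norm (E k - W k) \<le> 8 / 4 ^ k" for k
  proof -
    define r where "r = (1 / 2 ^ k :: real)"
    have r: "r \<ge> 0" "r\<^sup>2 = 1 / 4 ^ k"
      by (simp_all add: r_def power2_eq_square four_power)
    have "norm (E k - id_blinfun - r *\<^sub>R z) \<le> (norm (r *\<^sub>R z))\<^sup>2"
      unfolding E_def r_def by (rule exp_op_remainder[OF sk])
    also have "\<dots> = r\<^sup>2 * (norm z)\<^sup>2" by (simp add: power_mult_distrib)
    also have "\<dots> \<le> r\<^sup>2 * 2\<^sup>2"
      using nz pi_less_4 by (intro mult_left_mono power_mono) auto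
    finally have 1: "norm (E k - id_blinfun - r *\<^sub>R z) \<le> 4 / 4 ^ k" by (simp add: r)
    have "norm (r *\<^sub>R (z - Z k)) \<le> r * (2 / 2 ^ k)"
      using mult_left_mono[OF zZ[of k] r(1)] r(1) by simp
    also have "\<dots> = 2 / 4 ^ k" using r(2) by (simp add: r_def power2_eq_square)
    finally have 2: "norm (r *\<^sub>R (z - Z k)) \<le> 2 / 4 ^ k" .
    have "(id_blinfun - W k) o\<^sub>L (id_blinfun - adj (W k)) = 2 *\<^sub>R id_blinfun - W k - adj (W k)"
      by (simp add: comp_simps orth scaleR_2)
    moreover have "2 *\<^sub>R (W k - id_blinfun - r *\<^sub>R Z k)
        = - (2 *\<^sub>R id_blinfun - W k - adj (W k))"
      by (simp add: Z_def r_def scaleR_diff_right scaleR_2)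
    ultimately have "norm (2 *\<^sub>R (W k - id_blinfun - r *\<^sub>R Z k))
        = norm ((id_blinfun - W k) o\<^sub>L (id_blinfun - adj (W k)))"
      by (simp only: norm_minus_cancel)
    then have "2 * norm (W k - id_blinfun - r *\<^sub>R Z k)
        = norm ((id_blinfun - W k) o\<^sub>L (id_blinfun - adj (W k)))"
      by (simp only: norm_scaleR abs_numeral)
    then have 3: "norm (W k - id_blinfun - r *\<^sub>R Z k) \<le> 2 / 4 ^ k"
      using prod[of k] by simp
    have n3: "norm (p + q - s) \<le> norm p + norm q + norm s" for p q s :: "'a \<Rightarrow>\<^sub>L 'a"
      using norm_triangle_ineq4[of "p + q" s] norm_triangle_ineq[of p q] by linarith
    \<comment> \<open>Linearizing \<open>E k\<close>, replacing \<open>z\<close> by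
      \<open>Z k\<close> and linearizing \<open>W k\<close> cost 4, 2 and 2 times
      \<open>4^(-k)\<close>.\<close>
    have "E k - W k = (E k - id_blinfun - r *\<^sub>R z) + r *\<^sub>R (z - Z k) - (W k - id_blinfun - r *\<^sub>R Z k)"
      by (simp add: algebra_simps)
    then have "norm (E k - W k) \<le> norm (E k - id_blinfun - r *\<^sub>R z) + norm (r *\<^sub>R (z - Z k))
        + norm (W k - id_blinfun - r *\<^sub>R Z k)"
      by (simp only: n3)
    then show ?thesis using 1 2 3 by simp
  qed
  have step: "norm (E k - W k) \<le> 2 * norm (E (Suc k) - W (Suc k))" for k
  proof -
    have "E k - W k = (E (Suc k) o\<^sub>L (E (Suc k) - W (Suc k))) + ((E (Suc k) - W (Suc k)) o\<^sub>L W (Suc k))"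
      using E_sq[of k] sq[of k] by (simp add: comp_simps)
    then have "norm (E k - W k) \<le> norm (E (Suc k) o\<^sub>L (E (Suc k) - W (Suc k)))
        + norm ((E (Suc k) - W (Suc k)) o\<^sub>L W (Suc k))"
      by (simp add: norm_triangle_ineq)
    moreover have "norm (E (Suc k) o\<^sub>L (E (Suc k) - W (Suc k))) \<le> 1 * norm (E (Suc k) - W (Suc k))"
      by (rule order_trans[OF norm_blinfun_compose]) (intro mult_right_mono nE, simp)
    moreover have "norm ((E (Suc k) - W (Suc k)) o\<^sub>L W (Suc k)) \<le> norm (E (Suc k) - W (Suc k)) * 1"
      by (rule order_trans[OF norm_blinfun_compose]) (intro mult_left_mono nW, simp)
    ultimately show ?thesis by simp
  qed
  have iter: "norm (E 0 - W 0) \<le> 2 ^ k * norm (E k - W k)" for k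
  proof (induction k)
    case (Suc k)
    also have "2 ^ k * norm (E k - W k) \<le> 2 ^ k * (2 * norm (E (Suc k) - W (Suc k)))"
      by (intro mult_left_mono step) simp
    finally show ?case by (simp add: mult_ac)
  qed simp
  have "norm (E 0 - W 0) \<le> 8 / 2 ^ k" for k
  proof -
    have "norm (E 0 - W 0) \<le> 2 ^ k * (8 / 4 ^ k)"
      by (rule order_trans[OF iter mult_left_mono[OF near]]) simp
    then show ?thesis by (simp add: four_power)
  qed
  then have "norm (E 0 - W 0) \<le> 0" by (rule le_zero_if_le_divide_pow2)
  then have "exp_op z = W 0" by (simp add: E_def)
  then show thesis using that z skew nz unfolding Z_def by blast
qed

section \<open>Uniqueness of skew logarithms\<close>

text \<open>A curve on the unit sphere of speed at most \<open>\<pi> / 2\<close> stays for unit time within the angle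
  \<open>\<pi> / 2\<close> of its origin. The factor \<open>r < 1\<close> keeps \<open>arcsin\<close> away from its singularity.\<close>

lemma exp_op_real_part_nonneg:
  fixes z :: "'a::{real_inner,banach} \<Rightarrow>\<^sub>L 'a"
  assumes skew: "adj z = - z" and nz: "norm z \<le> pi / 2"
  shows "0 \<le> exp_op z x \<bullet> x"
proof (rule ccontr)
  assume neg: "\<not> ?thesis"
  then have x: "x \<noteq> 0" by auto
  define u where "u = (1 / norm x) *\<^sub>R x"
  define w where "w t = exp_op (t *\<^sub>R z) u" for t
  define F where "F t = w t \<bullet> u" for t
  define F' where "F' t = z (w t) \<bullet> u" for t
  have u: "norm u = 1" "u \<bullet> u = 1"
    using x by (simp_all add: u_def norm_eq_sqrt_inner[symmetric] dot_square_norm power2_eq_square)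
  have sk: "adj (t *\<^sub>R z) = - (t *\<^sub>R z)" for t by (simp add: skew)
  have w: "norm (w t) = 1" for t unfolding w_def using exp_op_orthogonal(2)[OF sk] u by simp
  have ww: "w t \<bullet> w t = 1" for t using w[of t] by (simp add: norm_eq_1)
  have F0: "F 0 = 1" by (simp add: F_def w_def u)
  have F1: "F 1 < 0"
  proof -
    have "F 1 = (1 / norm x)\<^sup>2 * (exp_op z x \<bullet> x)"
      by (simp add: F_def w_def u_def blinfun.bilinear_simps power2_eq_square)
    then show ?thesis using neg x by (simp add: mult_less_0_iff)
  qed
  have F_le: "\<bar>F t\<bar> \<le> 1" for t
    using Cauchy_Schwarz_ineq2[of "w t" u] by (simp add: F_def w u)
  have derF: "(F has_real_derivative F' t) (at t)" for t
  proof -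
    have "((\<lambda>t. exp_op (t *\<^sub>R z)) has_vector_derivative (z o\<^sub>L exp_op (t *\<^sub>R z))) (at t)"
      by (rule exp_op_has_vector_derivative)
    then have "((\<lambda>t. exp_op (t *\<^sub>R z) u \<bullet> u) has_vector_derivative
        ((z o\<^sub>L exp_op (t *\<^sub>R z)) u \<bullet> u)) (at t)"
      by (rule bounded_linear.has_vector_derivative[rotated])
        (intro bounded_linear_inner_left_comp blinfun.bounded_linear_left)
    then show ?thesis
      by (simp add: has_real_derivative_iff_has_vector_derivative F_def[abs_def] F'_def w_def)
  qed
  \<comment> \<open>Since \<open>z (w t)\<close> is orthogonal to \<open>w t\<close>, only the
    component of \<open>u\<close> orthogonal to \<open>w t\<close> matters, whose norm is
    \<open>sqrt (1 - F^2)\<close>.\<close>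
  have F'_le: "\<bar>F' t\<bar> \<le> norm z * sqrt (1 - (F t)\<^sup>2)" for t
  proof -
    have "z (w t) \<bullet> w t = 0"
      using adj_inner[of z "w t" "w t"] by (simp add: skew blinfun.bilinear_simps inner_commute)
    then have "F' t = z (w t) \<bullet> (u - F t *\<^sub>R w t)" by (simp add: F'_def inner_simps)
    then have "\<bar>F' t\<bar> \<le> norm (z (w t)) * norm (u - F t *\<^sub>R w t)"
      by (simp add: Cauchy_Schwarz_ineq2)
    also have "\<dots> \<le> norm z * norm (u - F t *\<^sub>R w t)"
      using norm_blinfun[of z "w t"] by (intro mult_right_mono) (auto simp: w)
    also have "norm (u - F t *\<^sub>R w t) = sqrt (1 - (F t)\<^sup>2)"
      by (simp add: norm_eq_sqrt_inner inner_simps ww u F_def[symmetric] power2_eq_square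
          inner_commute[of u "w t"] algebra_simps)
    finally show ?thesis .
  qed
  define a where "a = - F 1"
  have a: "0 < a" "a \<le> 1" using F1 F_le[of 1] by (auto simp: a_def)
  \<comment> \<open>With \<open>r^2 = s\<close>, \<open>arcsin (r F)\<close> goes from
    \<open>arcsin r\<close> to \<open>- arcsin (r a)\<close> in unit time at a speed of at most
    \<open>pi / 2\<close>. Hence \<open>arcsin r \<le> pi / 2 - arcsin (r a)\<close>, and taking
    sines gives \<open>r^2 \<le> 1 - r^2 a^2\<close>. As \<open>s\<close> tends to 1 this
    contradicts \<open>a > 0\<close>.\<close>
  have "s * (1 + a\<^sup>2) \<le> 1" if s: "0 < s" "s < 1" for s
  proof -
    define r where "r = sqrt s"
    have r: "0 < r" "r < 1" "r\<^sup>2 = s" using s by (simp_all add: r_def)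
    have rF: "\<bar>r * F t\<bar> < 1" for t
    proof -
      have "\<bar>r * F t\<bar> \<le> r * 1" using r F_le[of t] by (simp only: abs_mult, intro mult_mono) auto
      then show ?thesis using r by simp
    qed
    define G' where "G' t = inverse (sqrt (1 - (r * F t)\<^sup>2)) * (r * F' t)" for t
    have "((\<lambda>t. arcsin (r * F t)) has_real_derivative G' t) (at t)" for t
      unfolding G'_def
      by (rule DERIV_chain2[of arcsin, OF DERIV_arcsin])
        (use rF[of t] in \<open>auto intro!: derivative_eq_intros derF\<close>)
    then obtain t where t: "arcsin (r * F 1) - arcsin (r * F 0) = (1 - 0) * G' t"
      using MVT2[of 0 1 "\<lambda>t. arcsin (r * F t)" G'] by auto
    have "\<bar>G' t\<bar> \<le> norm z"
    proof -
      have p: "0 < sqrt (1 - (r * F t)\<^sup>2)" using rF[of t] by (simp add: abs_square_less_1)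
      have "r * \<bar>F' t\<bar> \<le> r * (norm z * sqrt (1 - (F t)\<^sup>2))"
        using F'_le[of t] r by (intro mult_left_mono) auto
      also have "\<dots> = norm z * sqrt (r\<^sup>2 * (1 - (F t)\<^sup>2))"
        using r(1) by (simp add: real_sqrt_mult)
      also have "\<dots> \<le> norm z * sqrt (1 - (r * F t)\<^sup>2)"
        using r s by (intro mult_left_mono real_sqrt_le_mono) (auto simp: power_mult_distrib algebra_simps)
      finally show ?thesis using p r by (simp add: G'_def abs_mult divide_simps mult_ac)
    qed
    then have "arcsin r + arcsin (r * a) \<le> pi / 2"
      using t nz F0 arcsin_minus[of "r * a"] rF[of 1] by (simp add: a_def)
    moreover have ra: "-1 \<le> r * a" "r * a \<le> 1" using rF[of 1] by (auto simp: a_def)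
    ultimately have "arcsin r \<le> pi / 2 - arcsin (r * a)" by simp
    then have "sin (arcsin r) \<le> sin (pi / 2 - arcsin (r * a))"
      using r ra arcsin_bounded[of r] arcsin_bounded[of "r * a"] arcsin_nonneg[of "r * a"] a
      by (intro sin_monotone_2pi_le) auto
    also have "\<dots> = cos (arcsin (r * a))"
      using cos_sin_eq[of "arcsin (r * a)"] by simp
    also have "\<dots> = sqrt (1 - (r * a)\<^sup>2)" using ra by (rule cos_arcsin)
    finally have "r \<le> sqrt (1 - (r * a)\<^sup>2)" using r by simp
    then have "r\<^sup>2 \<le> 1 - (r * a)\<^sup>2"
      using r by (metis less_eq_real_def real_sqrt_le_iff real_sqrt_abs abs_of_pos)
    then show ?thesis by (simp add: r(3)[symmetric] power_mult_distrib algebra_simps)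
  qed
  then have "1 + a\<^sup>2 \<le> 1" by (rule field_le_mult_one_interval)
  then show False using a by simp
qed

text \<open>The square of \<open>P + adj P\<close> depends only on \<open>P^2\<close>, so by
  uniqueness of positive roots \<open>S = P + adj P\<close> is the same for \<open>Q\<close>. Then
  \<open>S P = P^2 + 1 = S Q\<close>, and multiplying \<open>S (P - Q) = 0\<close> by
  \<open>P\<close> gives \<open>(P^2 + 1) (P - Q) = 0\<close>, where \<open>ker\<close>
  applies.\<close>

lemma orthogonal_root_unique:
  fixes P Q :: "'a::{real_inner,banach} \<Rightarrow>\<^sub>L 'a"
  assumes P: "adj P o\<^sub>L P = id_blinfun" "P o\<^sub>L adj P = id_blinfun" "\<And>x. 0 \<le> P x \<bullet> x"
    and Q: "adj Q o\<^sub>L Q = id_blinfun" "Q o\<^sub>L adj Q = id_blinfun" "\<And>x. 0 \<le> Q x \<bullet> x"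
    and sq: "P o\<^sub>L P = Q o\<^sub>L Q" and ker: "\<And>x. P (P x) = - x \<Longrightarrow> x = 0"
  shows "P = Q"
proof -
  have pos: "pos_op (A + adj A)" if "\<And>x. 0 \<le> A x \<bullet> x" for A :: "'a \<Rightarrow>\<^sub>L 'a"
    using that adj_inner[of "adj A" x x for x]
    by (simp add: pos_op_def add.commute blinfun.bilinear_simps inner_add_left)
      (simp add: inner_commute)
  have "adj P o\<^sub>L adj P = adj Q o\<^sub>L adj Q" using sq by (metis adj_comp)
  then have "(P + adj P) o\<^sub>L (P + adj P) = (Q + adj Q) o\<^sub>L (Q + adj Q)"
    using P Q sq by (simp add: comp_simps)
  then have re: "P + adj P = Q + adj Q" by (rule pos_op_root_unique[OF pos[OF P(3)] pos[OF Q(3)]])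
  have "(P + adj P) o\<^sub>L P = (P + adj P) o\<^sub>L Q"
    by (subst (2) re) (simp add: comp_simps P Q sq)
  then have "P o\<^sub>L ((P + adj P) o\<^sub>L (P - Q)) = 0" by (simp add: comp_simps)
  then have "(P o\<^sub>L P) o\<^sub>L (P - Q) = - (P - Q)"
    using P(2) by (simp add: comp_simps comp_assoc[symmetric] algebra_simps)
  then have "P (P ((P - Q) x)) = - (P - Q) x" for x
    by (metis blinfun.minus_left blinfun_apply_blinfun_compose)
  then have "(P - Q) x = 0" for x by (rule ker)
  then show ?thesis by (intro blinfun_eqI) (simp add: blinfun.bilinear_simps)
qed

lemma exp_op_skew_injective:
  fixes z w :: "'a::{real_inner,banach} \<Rightarrow>\<^sub>L 'a"
  assumes z: "adj z = - z" "norm z \<le> pi / 2" and w: "adj w = - w" "norm w \<le> pi / 2"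
    and eq: "exp_op (2 *\<^sub>R z) = exp_op (2 *\<^sub>R w)"
    and ker: "\<And>x. exp_op (2 *\<^sub>R z) x = - x \<Longrightarrow> x = 0"
  shows "z = w"
proof -
  have orth: "adj (exp_op (r *\<^sub>R v)) o\<^sub>L exp_op (r *\<^sub>R v) = id_blinfun"
    "exp_op (r *\<^sub>R v) o\<^sub>L adj (exp_op (r *\<^sub>R v)) = id_blinfun"
    if "adj v = - v" for r and v :: "'a \<Rightarrow>\<^sub>L 'a"
    using that exp_op_inverse[of "r *\<^sub>R v"] exp_op_inverse[of "- (r *\<^sub>R v)"]
    by (simp_all add: adj_exp_op)
  have pos: "0 \<le> exp_op ((1 / 2 ^ k) *\<^sub>R v) x \<bullet> x"
    if "adj v = - v" "norm v \<le> pi / 2" for k x and v :: "'a \<Rightarrow>\<^sub>L 'a"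
  proof (rule exp_op_real_part_nonneg)
    have "norm ((1 / 2 ^ k) *\<^sub>R v) = norm v / 2 ^ k" by simp
    also have "\<dots> \<le> norm v" by (simp add: divide_le_eq mult_le_cancel_left1)
    finally show "norm ((1 / 2 ^ k) *\<^sub>R v) \<le> pi / 2" using that(2) by linarith
  qed (simp add: that)
  have dbl: "exp_op ((1 / 2 ^ Suc k) *\<^sub>R v) o\<^sub>L exp_op ((1 / 2 ^ Suc k) *\<^sub>R v)
      = exp_op ((1 / 2 ^ k) *\<^sub>R v)" for k and v :: "'a \<Rightarrow>\<^sub>L 'a"
    using exp_op_double[of "(1 / 2 ^ Suc k) *\<^sub>R v"] by simp
  have roots: "exp_op ((1 / 2 ^ k) *\<^sub>R z) = exp_op ((1 / 2 ^ k) *\<^sub>R w)" for k :: nat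
  proof (induction k)
    case 0
    show ?case
    proof (rule orthogonal_root_unique[OF orth[OF z(1)] pos[OF z] orth[OF w(1)] pos[OF w]])
      show "exp_op ((1 / 2 ^ 0) *\<^sub>R z) o\<^sub>L exp_op ((1 / 2 ^ 0) *\<^sub>R z)
          = exp_op ((1 / 2 ^ 0) *\<^sub>R w) o\<^sub>L exp_op ((1 / 2 ^ 0) *\<^sub>R w)"
        using eq by (simp add: exp_op_double)
      show "x = 0" if "exp_op ((1 / 2 ^ 0) *\<^sub>R z) (exp_op ((1 / 2 ^ 0) *\<^sub>R z) x) = - x" for x
        using that ker[of x] by (simp add: exp_op_double)
    qed
  next
    case (Suc k)
    show ?case
    proof (rule orthogonal_root_unique[OF orth[OF z(1)] pos[OF z] orth[OF w(1)] pos[OF w]])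
      show "exp_op ((1 / 2 ^ Suc k) *\<^sub>R z) o\<^sub>L exp_op ((1 / 2 ^ Suc k) *\<^sub>R z)
          = exp_op ((1 / 2 ^ Suc k) *\<^sub>R w) o\<^sub>L exp_op ((1 / 2 ^ Suc k) *\<^sub>R w)"
        using Suc by (simp only: dbl)
      show "x = 0" if "exp_op ((1 / 2 ^ Suc k) *\<^sub>R z) (exp_op ((1 / 2 ^ Suc k) *\<^sub>R z) x) = - x" for x
      proof -
        have "exp_op ((1 / 2 ^ k) *\<^sub>R z) x = - x"
          using that dbl[of k z] by (metis blinfun_apply_blinfun_compose)
        \<comment> \<open>The nonnegative real part of \<open>e^(z / 2^k)\<close> excludes the
          eigenvalue -1. This replaces the kernel hypothesis used at the first level.\<close>
        then have "x \<bullet> x \<le> 0" using pos[OF z, of k x] by simp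
        then show ?thesis by (metis inner_eq_zero_iff inner_ge_zero order_antisym)
      qed
    qed
  qed
  \<comment> \<open>The exponentials of \<open>r z\<close> and \<open>r w\<close> agree for
    \<open>r = 1 / 2^k\<close>, and their remainders after the linear term are of order
    \<open>r^2\<close>. Division by \<open>r\<close> leaves a bound that vanishes as
    \<open>k\<close> grows.\<close>
  have "norm (z - w) \<le> ((norm z)\<^sup>2 + (norm w)\<^sup>2) / 2 ^ k" for k
  proof -
    define r where "r = (1 / 2 ^ k :: real)"
    have r: "0 < r" by (simp add: r_def)
    have "norm (exp_op (r *\<^sub>R v) - id_blinfun - r *\<^sub>R v) \<le> r\<^sup>2 * (norm v)\<^sup>2"
      if "adj v = - v" for v :: "'a \<Rightarrow>\<^sub>L 'a"
      using exp_op_remainder[of "r *\<^sub>R v"] that by (simp add: power_mult_distrib)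
    from norm_triangle_le_diff[OF add_mono[OF this[OF w(1)] this[OF z(1)]]]
    have "norm (r *\<^sub>R (z - w)) \<le> r\<^sup>2 * (norm w)\<^sup>2 + r\<^sup>2 * (norm z)\<^sup>2"
      using roots[of k] by (simp add: r_def scaleR_diff_right)
    moreover have "norm (r *\<^sub>R (z - w)) = r * norm (z - w)" using r by simp
    moreover have "r\<^sup>2 * (norm w)\<^sup>2 + r\<^sup>2 * (norm z)\<^sup>2 = r * (r * ((norm z)\<^sup>2 + (norm w)\<^sup>2))"
      by (simp add: power2_eq_square algebra_simps)
    ultimately have "r * norm (z - w) \<le> r * (r * ((norm z)\<^sup>2 + (norm w)\<^sup>2))" by linarith
    then have "norm (z - w) \<le> r * ((norm z)\<^sup>2 + (norm w)\<^sup>2)" using r by simp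
    then show ?thesis by (simp add: r_def)
  qed
  then have "norm (z - w) \<le> 0" by (rule le_zero_if_le_divide_pow2)
  then show ?thesis by simp
qed

subsection \<open>Geodesics\<close>

lemma exp_curve_in_lagrangian_grassmannian:
  assumes \<epsilon>: "\<epsilon> \<in> lagrangian_grassmannian J" and skew: "adj z = - z"
    and anti: "z o\<^sub>L \<epsilon> = - (\<epsilon> o\<^sub>L z)" and comm: "z o\<^sub>L J = J o\<^sub>L z"
  shows "exp_curve \<epsilon> z t \<in> lagrangian_grassmannian J"
proof -
  define y where "y = (2 * t) *\<^sub>R z"
  have e: "adj \<epsilon> = \<epsilon>" "\<epsilon> o\<^sub>L \<epsilon> = id_blinfun" "\<epsilon> o\<^sub>L J = - (J o\<^sub>L \<epsilon>)"
    using \<epsilon> by (auto simp: lagrangian_grassmannian_def grassmannian_def)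
  have y: "adj y = - y" "y o\<^sub>L J = J o\<^sub>L y" by (simp_all add: y_def skew comm comp_simps)
  have E\<epsilon>: "exp_op y o\<^sub>L \<epsilon> = \<epsilon> o\<^sub>L exp_op (- y)"
    by (rule exp_op_intertwine) (simp add: y_def anti comp_simps)
  have EJ: "exp_op y o\<^sub>L J = J o\<^sub>L exp_op y" by (rule exp_op_intertwine[OF y(2)])
  have c: "exp_curve \<epsilon> z t = exp_op y o\<^sub>L \<epsilon>" by (simp add: exp_curve_def y_def)
  have "adj (exp_curve \<epsilon> z t) = exp_curve \<epsilon> z t"
    by (simp add: c e adj_exp_op y(1) E\<epsilon>)
  moreover have "exp_curve \<epsilon> z t o\<^sub>L exp_curve \<epsilon> z t = id_blinfun"
  proof -
    have "exp_curve \<epsilon> z t o\<^sub>L exp_curve \<epsilon> z t = \<epsilon> o\<^sub>L (exp_op (- y) o\<^sub>L exp_op y) o\<^sub>L \<epsilon>"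
      unfolding c by (subst (1) E\<epsilon>) (simp add: comp_assoc)
    then show ?thesis by (simp add: exp_op_inverse e)
  qed
  moreover have "exp_curve \<epsilon> z t o\<^sub>L J = - (J o\<^sub>L exp_curve \<epsilon> z t)"
    by (simp add: c comp_assoc e comp_simps) (simp add: EJ flip: comp_assoc)
  ultimately show ?thesis by (simp add: lagrangian_grassmannian_def grassmannian_def)
qed

lemma exp_curve_has_vector_derivative:
  "(exp_curve \<epsilon> z has_vector_derivative (2 *\<^sub>R z) o\<^sub>L exp_curve \<epsilon> z t) (at t within T)"
proof -
  have "((\<lambda>t. exp_op (t *\<^sub>R (2 *\<^sub>R z)) o\<^sub>L \<epsilon>) has_vector_derivative
      ((2 *\<^sub>R z) o\<^sub>L exp_op (t *\<^sub>R (2 *\<^sub>R z))) o\<^sub>L \<epsilon>) (at t within T)"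
    by (intro bounded_linear.has_vector_derivative[OF bounded_bilinear.bounded_linear_left[OF
      bounded_bilinear_blinfun_compose]] exp_op_has_vector_derivative)
  then show ?thesis by (simp add: exp_curve_def[abs_def] comp_assoc mult.commute)
qed

lemma geodesic_exp_curve:
  assumes \<epsilon>: "\<epsilon> \<in> lagrangian_grassmannian J" and skew: "adj z = - z"
    and anti: "z o\<^sub>L \<epsilon> = - (\<epsilon> o\<^sub>L z)" and comm: "z o\<^sub>L J = J o\<^sub>L z" and ab: "a < b"
  shows "geodesic_in (lagrangian_grassmannian J) a b (exp_curve \<epsilon> z)"
proof -
  define \<gamma> where "\<gamma> = exp_curve \<epsilon> z"
  define V where "V t = (2 *\<^sub>R z) o\<^sub>L \<gamma> t" for t
  have mem: "\<gamma> t \<in> lagrangian_grassmannian J" for t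
    unfolding \<gamma>_def by (rule exp_curve_in_lagrangian_grassmannian[OF \<epsilon> skew anti comm])
  have d\<gamma>: "(\<gamma> has_vector_derivative V t) (at t within {a..b})" for t
    unfolding \<gamma>_def V_def by (rule exp_curve_has_vector_derivative)
  have dV: "(V has_vector_derivative (2 *\<^sub>R z) o\<^sub>L V t) (at t within {a..b})" for t
    unfolding V_def[abs_def]
    by (intro bounded_linear.has_vector_derivative[OF bounded_bilinear.bounded_linear_right[OF
      bounded_bilinear_blinfun_compose]] d\<gamma>[unfolded V_def])
  have "covariant_derivative \<gamma> V {a..b} t = 0" if "t \<in> {a..b}" for t
  proof -
    have "vector_derivative V (at t within {a..b}) = (2 *\<^sub>R z) o\<^sub>L V t"
      using vector_derivative_within_cbox[of a b t V] ab that dV by simp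
    \<comment> \<open>Each \<open>\<gamma> t\<close> anticommutes with \<open>z\<close> and so
      commutes with \<open>z^2\<close>. The second derivative \<open>4 z^2 \<gamma>\<close> is thus
      fixed by conjugation with \<open>\<gamma> t\<close>, and \<open>tangent_proj\<close> kills
      it.\<close>
    moreover have "z o\<^sub>L \<gamma> t = - (\<gamma> t o\<^sub>L z)"
    proof -
      have "z o\<^sub>L \<gamma> t = exp_op ((2 * t) *\<^sub>R z) o\<^sub>L (z o\<^sub>L \<epsilon>)"
        by (simp add: \<gamma>_def exp_curve_def exp_op_comp_commute flip: comp_assoc)
      then show ?thesis by (simp add: anti \<gamma>_def exp_curve_def comp_simps comp_assoc)
    qed
    moreover have "\<gamma> t o\<^sub>L \<gamma> t = id_blinfun"
      using mem[of t] by (simp add: lagrangian_grassmannian_def grassmannian_def)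
    ultimately show ?thesis
      by (simp add: covariant_derivative_def tangent_proj_def V_def comp_simps comp_assoc)
        (simp add: comp_simps flip: comp_assoc)
  qed
  moreover have "V differentiable (at t within {a..b})" for t
    using dV unfolding differentiable_def has_vector_derivative_def by blast
  ultimately show ?thesis
    unfolding geodesic_in_def \<gamma>_def[symmetric] using mem d\<gamma> by blast
qed

section \<open>Existence and uniqueness of the generator of the geodesic\<close>

lemma lagrangian_log_exists:
  fixes J \<epsilon>\<^sub>0 \<epsilon>\<^sub>1 :: "'a::{real_inner,banach} \<Rightarrow>\<^sub>L 'a"
  assumes J: "complex_structure J"
    and e0: "\<epsilon>\<^sub>0 \<in> lagrangian_grassmannian J" and e1: "\<epsilon>\<^sub>1 \<in> lagrangian_grassmannian J"
  obtains z where "adj z = - z" "z o\<^sub>L \<epsilon>\<^sub>0 = - (\<epsilon>\<^sub>0 o\<^sub>L z)" "z o\<^sub>L J = J o\<^sub>L z" "norm z \<le> pi / 2"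
    "exp_op (2 *\<^sub>R z) o\<^sub>L \<epsilon>\<^sub>0 = \<epsilon>\<^sub>1"
proof -
  have "\<forall>\<delta>\<in>lagrangian_grassmannian J. \<exists>\<epsilon>. \<epsilon> \<in> lagrangian_grassmannian J \<and>
      \<epsilon> o\<^sub>L \<epsilon>\<^sub>0 o\<^sub>L \<epsilon> = \<delta> \<and> (\<forall>x. 0 \<le> \<epsilon> (\<epsilon>\<^sub>0 x) \<bullet> x)"
    using lagrangian_midpoint[OF J e0] by blast
  from bchoice[OF this] obtain mid where mid: "mid \<delta> \<in> lagrangian_grassmannian J \<and>
      mid \<delta> o\<^sub>L \<epsilon>\<^sub>0 o\<^sub>L mid \<delta> = \<delta> \<and> (\<forall>x. 0 \<le> mid \<delta> (\<epsilon>\<^sub>0 x) \<bullet> x)"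
    if "\<delta> \<in> lagrangian_grassmannian J" for \<delta>
    by blast
  \<comment> \<open>The exponent \<open>Suc k\<close> skips \<open>\<epsilon>\<^sub>1\<close>
    itself: the real part of \<open>\<epsilon>\<^sub>1 \<epsilon>\<^sub>0\<close> may be negative,
    whereas midpoints give every \<open>W k\<close> a nonnegative one. So \<open>W 0\<close> is a
    square root of \<open>\<epsilon>\<^sub>1 \<epsilon>\<^sub>0\<close>, which accounts for the
    factor 2 in \<open>e^(2 z)\<close>.\<close>
  define e where "e k = (mid ^^ Suc k) \<epsilon>\<^sub>1" for k
  have mem: "e k \<in> lagrangian_grassmannian J" for k
    by (induction k) (simp_all add: e_def e1 mid)
  define W where "W k = e k o\<^sub>L \<epsilon>\<^sub>0" for k
  have s0: "adj \<epsilon>\<^sub>0 = \<epsilon>\<^sub>0" "\<epsilon>\<^sub>0 o\<^sub>L \<epsilon>\<^sub>0 = id_blinfun" "\<epsilon>\<^sub>0 o\<^sub>L J = - (J o\<^sub>L \<epsilon>\<^sub>0)"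
    using e0 by (auto simp: lagrangian_grassmannian_def grassmannian_def)
  have s: "adj (e k) = e k" "e k o\<^sub>L e k = id_blinfun" "e k o\<^sub>L J = - (J o\<^sub>L e k)" for k
    using mem[of k] by (auto simp: lagrangian_grassmannian_def grassmannian_def)
  have canc: "\<epsilon>\<^sub>0 o\<^sub>L (\<epsilon>\<^sub>0 o\<^sub>L A) = A" "e k o\<^sub>L (e k o\<^sub>L A) = A" for k and A :: "'a \<Rightarrow>\<^sub>L 'a"
    by (simp_all add: s s0 flip: comp_assoc)
  have adjW: "adj (W k) = \<epsilon>\<^sub>0 o\<^sub>L e k" for k by (simp add: W_def s s0)
  have "adj (W k) o\<^sub>L W k = id_blinfun" "W k o\<^sub>L adj (W k) = id_blinfun" for k
    by (simp_all add: adjW W_def comp_assoc canc s s0)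
  moreover have "W (Suc k) o\<^sub>L W (Suc k) = W k" for k
  proof -
    have "e (Suc k) o\<^sub>L \<epsilon>\<^sub>0 o\<^sub>L e (Suc k) = e k" using mid[OF mem[of k]] by (simp add: e_def)
    then show ?thesis by (simp add: W_def flip: comp_assoc)
  qed
  moreover have "0 \<le> W k x \<bullet> x" for k x
    using mid[OF e1] mid[OF mem] by (cases k) (simp_all add: W_def e_def)
  ultimately obtain z where z: "(\<lambda>k. (2 ^ k / 2) *\<^sub>R (W k - adj (W k))) \<longlonglongrightarrow> z"
    and skew: "adj z = - z" and nz: "norm z \<le> pi / 2" and exp: "exp_op z = W 0"
    by (rule orthogonal_log_exists)
  define Z where "Z k = (2 ^ k / 2) *\<^sub>R (W k - adj (W k))" for k
  have Z: "Z \<longlonglongrightarrow> z" using z by (simp add: Z_def[abs_def])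
  note limR = bounded_linear.tendsto[OF bounded_bilinear.bounded_linear_right[OF
      bounded_bilinear_blinfun_compose] Z]
  note limL = bounded_linear.tendsto[OF bounded_bilinear.bounded_linear_left[OF
      bounded_bilinear_blinfun_compose] Z]
  show thesis
  proof (rule that[OF skew _ _ nz])
    \<comment> \<open>Conjugation by \<open>\<epsilon>\<^sub>0\<close> takes \<open>W k\<close> to
      its adjoint, and \<open>J\<close> commutes with \<open>W k\<close>, a product of two operators
      that anticommute with \<open>J\<close>. Both relations pass to the norm limit
      \<open>z\<close>.\<close>
    have "Z k o\<^sub>L \<epsilon>\<^sub>0 = - (\<epsilon>\<^sub>0 o\<^sub>L Z k)" for k
      by (simp add: Z_def adjW W_def comp_simps comp_assoc canc s s0 algebra_simps)
    then have "(\<lambda>k. Z k o\<^sub>L \<epsilon>\<^sub>0) \<longlonglongrightarrow> - (\<epsilon>\<^sub>0 o\<^sub>L z)"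
      using tendsto_minus[OF limR[of \<epsilon>\<^sub>0]] by simp
    then show "z o\<^sub>L \<epsilon>\<^sub>0 = - (\<epsilon>\<^sub>0 o\<^sub>L z)" by (rule LIMSEQ_unique[OF limL])
    have "e k o\<^sub>L (\<epsilon>\<^sub>0 o\<^sub>L J) = J o\<^sub>L (e k o\<^sub>L \<epsilon>\<^sub>0)" "\<epsilon>\<^sub>0 o\<^sub>L (e k o\<^sub>L J) = J o\<^sub>L (\<epsilon>\<^sub>0 o\<^sub>L e k)" for k
      by (simp_all add: s s0 comp_simps) (simp_all add: s s0 comp_simps flip: comp_assoc)
    then have "Z k o\<^sub>L J = J o\<^sub>L Z k" for k
      by (simp add: Z_def adjW W_def comp_simps comp_assoc s(1) s0(1))
    then have "(\<lambda>k. Z k o\<^sub>L J) \<longlonglongrightarrow> (J o\<^sub>L z)" using limR[of J] by simp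
    then show "z o\<^sub>L J = J o\<^sub>L z" by (rule LIMSEQ_unique[OF limL])
    have "mid \<epsilon>\<^sub>1 o\<^sub>L \<epsilon>\<^sub>0 o\<^sub>L mid \<epsilon>\<^sub>1 = \<epsilon>\<^sub>1" using mid[OF e1] by blast
    then show "exp_op (2 *\<^sub>R z) o\<^sub>L \<epsilon>\<^sub>0 = \<epsilon>\<^sub>1"
      by (simp add: exp_op_double exp W_def e_def comp_assoc s0)
  qed
qed

lemma lagrangian_log_unique:
  fixes \<epsilon>\<^sub>0 \<epsilon>\<^sub>1 :: "'a::{real_inner,banach} \<Rightarrow>\<^sub>L 'a"
  assumes e0: "\<epsilon>\<^sub>0 \<in> grassmannian" and dist: "norm (\<epsilon>\<^sub>0 - \<epsilon>\<^sub>1) < 2"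
    and z: "adj z = - z" "norm z \<le> pi / 2" "exp_op (2 *\<^sub>R z) o\<^sub>L \<epsilon>\<^sub>0 = \<epsilon>\<^sub>1"
    and w: "adj w = - w" "norm w \<le> pi / 2" "exp_op (2 *\<^sub>R w) o\<^sub>L \<epsilon>\<^sub>0 = \<epsilon>\<^sub>1"
  shows "z = w"
proof (rule exp_op_skew_injective[OF z(1,2) w(1,2)])
  note g0 = grassmannianD[OF e0]
  have "(exp_op (2 *\<^sub>R z) o\<^sub>L \<epsilon>\<^sub>0) o\<^sub>L \<epsilon>\<^sub>0 = (exp_op (2 *\<^sub>R w) o\<^sub>L \<epsilon>\<^sub>0) o\<^sub>L \<epsilon>\<^sub>0" using z w by simp
  then show "exp_op (2 *\<^sub>R z) = exp_op (2 *\<^sub>R w)"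
    using e0 by (simp add: comp_assoc grassmannian_def)
  fix x assume "exp_op (2 *\<^sub>R z) x = - x"
  \<comment> \<open>An eigenvector \<open>x\<close> of
    \<open>\<epsilon>\<^sub>1 \<epsilon>\<^sub>0\<close> for -1 would make
    \<open>\<epsilon>\<^sub>0 - \<epsilon>\<^sub>1\<close> double the norm of
    \<open>\<epsilon>\<^sub>0 x\<close>.\<close>
  then have "\<epsilon>\<^sub>1 (\<epsilon>\<^sub>0 x) = - x" by (simp add: z(3)[symmetric] g0)
  then have "(\<epsilon>\<^sub>0 - \<epsilon>\<^sub>1) (\<epsilon>\<^sub>0 x) = 2 *\<^sub>R x"
    by (simp add: blinfun.bilinear_simps g0 scaleR_2)
  then have "2 * norm x \<le> norm (\<epsilon>\<^sub>0 - \<epsilon>\<^sub>1) * norm x"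
    using norm_blinfun[of "\<epsilon>\<^sub>0 - \<epsilon>\<^sub>1" "\<epsilon>\<^sub>0 x"] by (simp add: g0)
  then show "x = 0" using dist by (simp add: mult_le_cancel_right)
qed

theorem theorem2p4:
  fixes J \<epsilon>\<^sub>0 \<epsilon>\<^sub>1 :: "'a::{real_inner,banach} \<Rightarrow>\<^sub>L 'a"
  assumes "complex_structure J"
    and "\<epsilon>\<^sub>0 \<in> lagrangian_grassmannian J"
    and "\<epsilon>\<^sub>1 \<in> lagrangian_grassmannian J"
  shows "(\<exists>z :: 'a \<Rightarrow>\<^sub>L 'a.
            adj z = - z \<and> z o\<^sub>L \<epsilon>\<^sub>0 = - (\<epsilon>\<^sub>0 o\<^sub>L z) \<and> z o\<^sub>L J = J o\<^sub>L z \<and> norm z \<le> pi / 2 \<and>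
            geodesic_in (lagrangian_grassmannian J) 0 1 (exp_curve \<epsilon>\<^sub>0 z) \<and>
            exp_curve \<epsilon>\<^sub>0 z 0 = \<epsilon>\<^sub>0 \<and> exp_curve \<epsilon>\<^sub>0 z 1 = \<epsilon>\<^sub>1) \<and>
         (norm (\<epsilon>\<^sub>0 - \<epsilon>\<^sub>1) < 2 \<longrightarrow>
            (\<forall>z w :: 'a \<Rightarrow>\<^sub>L 'a.
               adj z = - z \<and> z o\<^sub>L \<epsilon>\<^sub>0 = - (\<epsilon>\<^sub>0 o\<^sub>L z) \<and> z o\<^sub>L J = J o\<^sub>L z \<and> norm z \<le> pi / 2 \<and>
               exp_curve \<epsilon>\<^sub>0 z 1 = \<epsilon>\<^sub>1 \<and>
               adj w = - w \<and> w o\<^sub>L \<epsilon>\<^sub>0 = - (\<epsilon>\<^sub>0 o\<^sub>L w) \<and> w o\<^sub>L J = J o\<^sub>L w \<and> norm w \<le> pi / 2 \<and>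
               exp_curve \<epsilon>\<^sub>0 w 1 = \<epsilon>\<^sub>1
               \<longrightarrow> (\<forall>t\<in>{0..1}. exp_curve \<epsilon>\<^sub>0 z t = exp_curve \<epsilon>\<^sub>0 w t)))"
proof (intro conjI impI allI ballI)
  obtain z where z: "adj z = - z" "z o\<^sub>L \<epsilon>\<^sub>0 = - (\<epsilon>\<^sub>0 o\<^sub>L z)" "z o\<^sub>L J = J o\<^sub>L z" "norm z \<le> pi / 2"
    "exp_op (2 *\<^sub>R z) o\<^sub>L \<epsilon>\<^sub>0 = \<epsilon>\<^sub>1"
    by (rule lagrangian_log_exists[OF assms])
  have "geodesic_in (lagrangian_grassmannian J) 0 1 (exp_curve \<epsilon>\<^sub>0 z)"
    by (rule geodesic_exp_curve[OF assms(2) z(1-3)]) simp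
  then show "\<exists>z :: 'a \<Rightarrow>\<^sub>L 'a.
      adj z = - z \<and> z o\<^sub>L \<epsilon>\<^sub>0 = - (\<epsilon>\<^sub>0 o\<^sub>L z) \<and> z o\<^sub>L J = J o\<^sub>L z \<and> norm z \<le> pi / 2 \<and>
      geodesic_in (lagrangian_grassmannian J) 0 1 (exp_curve \<epsilon>\<^sub>0 z) \<and>
      exp_curve \<epsilon>\<^sub>0 z 0 = \<epsilon>\<^sub>0 \<and> exp_curve \<epsilon>\<^sub>0 z 1 = \<epsilon>\<^sub>1"
    using z by (auto simp: exp_curve_def)
next
  fix z w :: "'a \<Rightarrow>\<^sub>L 'a" and t :: real
  assume dist: "norm (\<epsilon>\<^sub>0 - \<epsilon>\<^sub>1) < 2"
    and zw: "adj z = - z \<and> z o\<^sub>L \<epsilon>\<^sub>0 = - (\<epsilon>\<^sub>0 o\<^sub>L z) \<and> z o\<^sub>L J = J o\<^sub>L z \<and> norm z \<le> pi / 2 \<and>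
      exp_curve \<epsilon>\<^sub>0 z 1 = \<epsilon>\<^sub>1 \<and>
      adj w = - w \<and> w o\<^sub>L \<epsilon>\<^sub>0 = - (\<epsilon>\<^sub>0 o\<^sub>L w) \<and> w o\<^sub>L J = J o\<^sub>L w \<and> norm w \<le> pi / 2 \<and>
      exp_curve \<epsilon>\<^sub>0 w 1 = \<epsilon>\<^sub>1"
  have "z = w"
    by (rule lagrangian_log_unique[OF lagrangian_grassmannianD(1)[OF assms(2)] dist])
      (use zw in \<open>auto simp: exp_curve_def\<close>)
  then show "exp_curve \<epsilon>\<^sub>0 z t = exp_curve \<epsilon>\<^sub>0 w t" by simp
qed

end
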